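(* Let $\Phi=\{\phi_1,\ldots,\phi_N\}$, $N\geq 2$, be an iterated function system of contracting similarities of $\mathbb{R}$ that satisfies the open set condition, and let $F\subseteq\mathbb{R}$ be the self-similar set generated by $\Phi$. Suppose that $F$ is nontrivial, i.e. $\dim_M(F)<1$. Then $F$ is Minkowski measurable if and only if $\Phi$ is nonlattice.
   Context: Let $\Phi=\{\phi_1,\ldots,\phi_N\}$ be an iterated function system (IFS) consisting of $N\ge 2$ contracting similarities $\phi_i:\mathbb{R}\to\mathbb{R}$, with similarity ratios $r_i\in(0,1)$, and let $\Sigma=\{1,\ldots,N\}$. Open set condition (OSC): there exists a nonempty open set $O\subseteq\mathbb{R}$ with $\phi_i(O)\subseteq O$ for all $i\in\Sigma$ and $\phi_i(O)\cap\phi_j(O)=\emptyset$ for all $i\neq j$ in $\Sigma$. $\Phi$ is lattice if $\{\log r_i : i\in\Sigma\}$ generates a discrete subgroup of $(\mathbb{R},+)$; otherwise it is nonlattice. The self-similar set generated by (associated with) $\Phi$ is the unique nonempty compact set $F\subseteq\mathbb{R}$ with $F=\bigcup_{i\in\Sigma}\phi_i(F)$. For compact $A\subseteq\mathbb{R}$ and $\varepsilon>0$ let $A_\varepsilon=\{x\in\mathbb{R}: \inf_{a\in A}|x-a|\le\varepsilon\}$, and let $\lambda$ be Lebesgue measure on $\mathbb{R}$. The Minkowski dimension is $\dim_M(A)=1-\lim_{\varepsilon\searrow0}\log(\lambda(A_\varepsilon))/\log(\varepsilon)$ if the limit exists (it is well known that it exists for $F$ under OSC). The Minkowski content is $\mathcal{M}(A)=\lim_{\varepsilon\searrow0}\varepsilon^{\dim_M(A)-1}\lambda(A_\varepsilon)$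 if the limit exists. $A$ is Minkowski measurable if $\mathcal{M}(A)$ exists and is positive and finite. $F$ is nontrivial if $\dim_M(F)<1$. *)

theory Defs
  imports "HOL-Analysis.Analysis" "HOL-Computational_Algebra.Group_Closure"
begin

section \<open>Iterated function systems of similarities of the real line\<close>

text \<open>
  A system of \<open>N\<close> maps is the restriction of \<open>\<phi>\<close> to the index set \<open>{1..N}\<close>; the values of \<open>\<phi>\<close>
  and of the ratios \<open>r\<close> outside \<open>{1..N}\<close> play no role.  Orientation-reversing similarities are
  included.
\<close>

definition contracting_similarities ::
    "nat \<Rightarrow> (nat \<Rightarrow> real \<Rightarrow> real) \<Rightarrow> (nat \<Rightarrow> real) \<Rightarrow> bool" where
  "contracting_similarities N \<phi> r \<longleftrightarrow>
     (\<forall>i\<in>{1..N}. 0 < r i \<and> r i < 1 \<and> (\<forall>x y. dist (\<phi> i x) (\<phi> i y) = r i * dist x y))"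

definition open_set_condition :: "nat \<Rightarrow> (nat \<Rightarrow> real \<Rightarrow> real) \<Rightarrow> bool" where
  "open_set_condition N \<phi> \<longleftrightarrow>
     (\<exists>U. open U \<and> U \<noteq> {} \<and> (\<forall>i\<in>{1..N}. \<phi> i ` U \<subseteq> U) \<and>
          (\<forall>i\<in>{1..N}. \<forall>j\<in>{1..N}. i \<noteq> j \<longrightarrow> \<phi> i ` U \<inter> \<phi> j ` U = {}))"

definition lattice_ratios :: "nat \<Rightarrow> (nat \<Rightarrow> real) \<Rightarrow> bool" where
  "lattice_ratios N r \<longleftrightarrow> discrete (group_closure ((\<lambda>i. ln (r i)) ` {1..N}))"

text \<open>By Hutchinson's theorem, exactly one set satisfies the following predicate when the maps
  are contractions and \<open>N \<ge> 1\<close>.\<close>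

definition generates_self_similar_set ::
    "nat \<Rightarrow> (nat \<Rightarrow> real \<Rightarrow> real) \<Rightarrow> real set \<Rightarrow> bool" where
  "generates_self_similar_set N \<phi> F \<longleftrightarrow>
     compact F \<and> F \<noteq> {} \<and> F = (\<Union>i\<in>{1..N}. \<phi> i ` F)"


section \<open>Minkowski dimension and content\<close>

text \<open>The notions below are intended for nonempty compact sets; note that \<open>infdist x {} = 0\<close>.\<close>

definition parallel_set :: "real set \<Rightarrow> real \<Rightarrow> real set" where
  "parallel_set A \<epsilon> = {x. infdist x A \<le> \<epsilon>}"

definition minkowski_dim_exists :: "real set \<Rightarrow> bool" where
  "minkowski_dim_exists A \<longleftrightarrow>
     (\<exists>l. ((\<lambda>\<epsilon>. ln (measure lborel (parallel_set A \<epsilon>)) / ln \<epsilon>) \<longlongrightarrow> l) (at_right 0))"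

text \<open>The value is meaningful only if \<^const>\<open>minkowski_dim_exists\<close> holds; this is the case for
  self-similar sets satisfying the open set condition.\<close>

definition minkowski_dim :: "real set \<Rightarrow> real" where
  "minkowski_dim A =
     1 - Lim (at_right 0) (\<lambda>\<epsilon>. ln (measure lborel (parallel_set A \<epsilon>)) / ln \<epsilon>)"

text \<open>The content is an extended real, so that finiteness is a separate requirement.\<close>

definition has_minkowski_content :: "real set \<Rightarrow> ereal \<Rightarrow> bool" where
  "has_minkowski_content A M \<longleftrightarrow> minkowski_dim_exists A \<and>
     ((\<lambda>\<epsilon>. ereal (\<epsilon> powr (minkowski_dim A - 1) * measure lborel (parallel_set A \<epsilon>)))
        \<longlongrightarrow> M) (at_right 0)"

definition minkowski_measurable :: "real set \<Rightarrow> bool" where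
  "minkowski_measurable A \<longleftrightarrow> (\<exists>M. has_minkowski_content A M \<and> 0 < M \<and> M < \<infinity>)"

end

theory Submission
  imports Defs
begin

text \<open>
  Write \<open>V(\<epsilon>)\<close> for the measure of the parallel set of \<open>F\<close> and \<open>D\<close> for the solution of Moran's
  equation \<open>\<Sum> r\<^sub>i\<^sup>D = 1\<close>.  Covering \<open>F\<close> by cylinders of size about \<open>\<epsilon>\<close> gives \<open>V(\<epsilon>) \<le> C \<epsilon>\<^bsup>1-D\<^esup>\<close>
  (\<open>tube_upper_bound\<close>), and packing copies of an interval of the open set gives
  \<open>c \<epsilon>\<^bsup>1-D\<^esup> \<le> V(\<epsilon>)\<close> (\<open>tube_lower_bound\<close>).  Hence the Minkowski dimension is \<open>D\<close>, and measurability
  means that \<open>f(t) = e\<^bsup>t(1-D)\<^esup> V(e\<^bsup>-t\<^esup>)\<close> converges at infinity; a limit is automatically positive and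
  finite.

  Nonlattice systems.  Subadditivity of measure, applied to \<open>F = \<Union> \<phi>\<^sub>i F\<close>, gives the renewal
  inequality \<open>f(t) \<le> \<Sum> p\<^sub>i f(t - \<tau>\<^sub>i)\<close> with the probabilities \<open>p\<^sub>i = r\<^sub>i\<^sup>D\<close> and the steps
  \<open>\<tau>\<^sub>i = - log r\<^sub>i\<close>.  In this one-sided form it already forces convergence.  Indeed the
  weighted average \<open>Q(t) = \<Sum> p\<^sub>i \<integral>\<^bsub>t-\<tau>\<^sub>i\<^esub>\<^bsup>t\<^esup> f\<close> is decreasing.  Where \<open>f\<close> is close to its upper limit \<open>L\<close>, the inequality
  forces it to be close to \<open>L\<close> at all earlier times that differ by a sum of steps.  In the nonlattice
  case these sums become dense at infinity, so \<open>f\<close> is close to \<open>L\<close> on whole windows, and \<open>Q\<close> is at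
  least \<open>L \<Sum> p\<^sub>i \<tau>\<^sub>i\<close> everywhere by monotonicity.  Dips of \<open>f\<close> below \<open>L\<close> at late times would contradict
  this (\<open>renewal_inequality_limit\<close>).

  Lattice systems.  The growth rate of \<open>V\<close> at \<open>\<epsilon>\<close> is governed by the number of gaps of \<open>F\<close> longer than
  \<open>2\<epsilon>\<close>, so \<open>V(\<epsilon>) \<sim> M \<epsilon>\<^bsup>1-D\<^esup>\<close> would imply that the number of gaps longer than \<open>\<delta>\<close> is asymptotic to
  \<open>G \<delta>\<^bsup>-D\<^esup>\<close> with \<open>G > 0\<close>, because \<open>D < 1\<close> (\<open>gap_count_asymptotics\<close>).  In particular the number of gaps
  of length exactly \<open>l\<close> would be \<open>o(l\<^bsup>-D\<^esup>)\<close> (\<open>few_gaps_of_equal_length\<close>).  But if all ratios are powers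
  of a single \<open>\<rho>\<close>, then the gaps with lengths in \<open>(\<rho>\<^bsup>n+1\<^esup>, \<rho>\<^sup>n]\<close> have, up to an arbitrarily small
  proportion, only boundedly many lengths.  The reason is a word \<open>w\<close> such that the cylinder of \<open>kw\<close>
  is, relative to its size, far from the part of \<open>F\<close> outside the cylinder of \<open>k\<close>, for every word \<open>k\<close>
  (\<open>isolating_word\<close>).  Short gaps that start in the cylinder of \<open>kw\<close> are then images of gaps of \<open>F\<close>
  of size bounded below, of which there are finitely many, and the proportion of words of a given
  size in which \<open>w\<close> does not occur near the end is small (\<open>avoiding_words\<close>).  Counting gaps gives
  \<open>lattice_gap_bound\<close> and the contradiction.
\<close>

section \<open>Subgroups and subsemigroups of the real line\<close>

lemma group_closure_multiple:
  fixes S :: "real set"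
  assumes "s \<in> group_closure S"
  shows "of_int k * s \<in> group_closure S"
proof (cases "0 \<le> k")
  case True
  with group_closure_scalar_mult_left[OF assms, of "nat k"] show ?thesis by simp
next
  case False
  then have "of_int k * s = - (of_nat (nat (- k)) * s)" by simp
  then show ?thesis using group_closure_scalar_mult_left[OF assms] group_closure_minus_iff by metis
qed

text \<open>
  A discrete subgroup of the line has a least positive element, and division with remainder
  by it shows that it generates the subgroup.
\<close>

lemma discrete_group_closure_cyclic:
  fixes S :: "real set"
  assumes disc: "discrete (group_closure S)" and s0: "s0 \<in> S" "s0 \<noteq> 0"
  obtains h where "0 < h" "\<And>s. s \<in> S \<Longrightarrow> \<exists>k::int. s = of_int k * h"
proof -
  define G where "G = group_closure S"
  have Gdiff: "x - y \<in> G" if "x \<in> G" "y \<in> G" for x y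
    using that unfolding G_def by (rule group_closure.diff)
  have "0 isolated_in G"
    using disc by (auto simp: G_def discrete_def)
  then obtain e where e: "e > 0" "\<And>y. y \<in> G \<Longrightarrow> \<bar>y\<bar> < e \<Longrightarrow> y = 0"
    unfolding isolated_in_dist_Ex_iff by (auto simp: dist_real_def)
  define P where "P = {x \<in> G. 0 < x}"
  have "\<bar>s0\<bar> \<in> P"
    using s0 group_closure.base[of s0 S] by (auto simp: P_def G_def abs_if)
  then have ne: "P \<noteq> {}" by blast
  have bdd: "bdd_below P" by (rule bdd_belowI[of _ 0]) (simp add: P_def)
  \<comment> \<open>Two elements of \<open>P\<close> within \<open>e\<close> of each other coincide, so an element this close to the
    infimum is the minimum.\<close>
  obtain h where h: "h \<in> P" "h < Inf P + e"
    using cInf_lessD[OF ne, of "Inf P + e"] e(1) by auto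
  have hmin: "h \<le> x" if "x \<in> P" for x
  proof (rule ccontr)
    assume "\<not> h \<le> x"
    moreover have "Inf P \<le> x" using that bdd by (rule cInf_lower)
    ultimately have "\<bar>h - x\<bar> < e" using h by auto
    moreover have "h - x \<in> G" using Gdiff h(1) that by (simp add: P_def)
    ultimately have "h - x = 0" by (rule e(2)[rotated])
    with \<open>\<not> h \<le> x\<close> show False by simp
  qed
  have hpos: "h > 0" using h(1) by (simp add: P_def)
  have "\<exists>k::int. s = of_int k * h" if "s \<in> S" for s
  proof
    let ?x = "s - of_int \<lfloor>s / h\<rfloor> * h"
    have "?x \<in> G"
      using Gdiff h(1) that group_closure.base[of s S] group_closure_multiple[of h S]
      by (auto simp: P_def G_def)
    moreover have "0 \<le> ?x" "?x < h"
      using hpos floor_divide_lower[of h s] floor_divide_upper[of h s] by (auto simp: algebra_simps)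
    ultimately have "?x = 0"
      using hmin[of ?x] unfolding P_def by force
    then show "s = of_int \<lfloor>s / h\<rfloor> * h" by simp
  qed
  with hpos that show thesis by blast
qed

lemma nondiscrete_group_closure_small:
  fixes S :: "real set"
  assumes "\<not> discrete (group_closure S)" "0 < e"
  obtains g where "g \<in> group_closure S" "0 < g" "g < e"
proof -
  obtain x where x: "x \<in> group_closure S" "\<not> x isolated_in group_closure S"
    using assms(1) by (auto simp: discrete_def)
  then obtain y where y: "y \<in> group_closure S" "y \<noteq> x" "dist x y < e"
    using assms(2) unfolding isolated_in_dist_Ex_iff by (metis)
  have "\<bar>x - y\<bar> \<in> group_closure S"
    using group_closure.diff[OF x(1) y(1)] group_closure.diff[OF y(1) x(1)] by (auto simp: abs_if)
  with y that[of "\<bar>x - y\<bar>"] show thesis by (auto simp: dist_real_def)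
qed

text \<open>
  For the steps \<open>\<tau>\<^sub>i = - ln r\<^sub>i\<close> these are the numbers \<open>- ln r\<^sub>u\<close> of all words \<open>u\<close>, that is, the total
  lags that iteration of the renewal inequality can reach.
\<close>

inductive_set semigroup_closure :: "real set \<Rightarrow> real set" for T where
  zero: "0 \<in> semigroup_closure T"
| add: "g \<in> semigroup_closure T \<Longrightarrow> t \<in> T \<Longrightarrow> g + t \<in> semigroup_closure T"

lemma semigroup_closure_add:
  assumes "a \<in> semigroup_closure T" "b \<in> semigroup_closure T"
  shows "a + b \<in> semigroup_closure T"
  using assms(2,1)
proof induction
  case (add g t)
  then have "(a + g) + t \<in> semigroup_closure T"
    using semigroup_closure.add[of "a + g" T t] by blast
  then show ?case by (simp add: add.assoc)
qed simp

lemma semigroup_closure_multiple: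
  assumes "a \<in> semigroup_closure T"
  shows "real n * a \<in> semigroup_closure T"
proof (induction n)
  case (Suc n)
  from semigroup_closure_add[OF this assms] show ?case by (simp add: algebra_simps)
qed (simp add: semigroup_closure.zero)

lemma semigroup_closure_nonneg:
  "\<lbrakk>g \<in> semigroup_closure T; \<And>t. t \<in> T \<Longrightarrow> 0 \<le> t\<rbrakk> \<Longrightarrow> 0 \<le> g"
  by (induction rule: semigroup_closure.induct) auto

lemma group_closure_difference:
  assumes "g \<in> group_closure (uminus ` T)"
  obtains a b where "a \<in> semigroup_closure T" "b \<in> semigroup_closure T" "g = a - b"
proof -
  have "\<exists>a b. a \<in> semigroup_closure T \<and> b \<in> semigroup_closure T \<and> g = a - b"
    using assms
  proof induction
    case (base s)
    show ?case
    proof (cases "s = 0")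
      case True
      then show ?thesis using semigroup_closure.zero by force
    next
      case False
      then obtain t where "t \<in> T" "s = - t" using base by auto
      then show ?thesis
        using semigroup_closure.zero semigroup_closure.add[OF semigroup_closure.zero, of t T]
        by (intro exI[of _ 0] exI[of _ t]) auto
    qed
  next
    case (diff s t)
    then obtain a b c d where "a \<in> semigroup_closure T" "b \<in> semigroup_closure T" "s = a - b"
      "c \<in> semigroup_closure T" "d \<in> semigroup_closure T" "t = c - d" by blast
    then show ?case
      by (intro exI[of _ "a + d"] exI[of _ "b + c"]) (auto intro: semigroup_closure_add)
  qed
  with that show thesis by blast
qed

text \<open>
  A nondiscrete group has an element \<open>g = a - b\<close> in \<open>(0, e)\<close> with \<open>a\<close>, \<open>b\<close> in the semigroup.  The
  semigroup contains \<open>m b + j g = (m - j) b + j a\<close> for \<open>0 \<le> j \<le> m\<close>, an \<open>e\<close>-net of \<open>[m b, m a]\<close>, and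
  these intervals overlap as soon as \<open>m g \<ge> b\<close>.
\<close>

lemma semigroup_closure_eventually_dense:
  assumes T: "\<And>t. t \<in> T \<Longrightarrow> 0 < t"
    and nd: "\<not> discrete (group_closure (uminus ` T))" and "0 < e"
  obtains S where "\<And>s. S \<le> s \<Longrightarrow> \<exists>g \<in> semigroup_closure T. \<bar>g - s\<bar> < e"
proof -
  obtain g where g: "g \<in> group_closure (uminus ` T)" "0 < g" "g < e"
    using nondiscrete_group_closure_small[OF nd \<open>0 < e\<close>] by blast
  obtain a b where ab: "a \<in> semigroup_closure T" "b \<in> semigroup_closure T" "g = a - b"
    using group_closure_difference[OF g(1)] by blast
  have b0: "0 \<le> b" using semigroup_closure_nonneg[OF ab(2)] T by force
  then have a0: "0 < a" using g ab by simp
  have "\<exists>x \<in> semigroup_closure T. \<bar>x - s\<bar> < e" if s: "a * (b / g + 1) \<le> s" for s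
  proof -
    have s0: "0 \<le> s" using s a0 b0 g(2) by (smt (verit) divide_nonneg_nonneg mult_nonneg_nonneg)
    define n where "n = nat \<lfloor>s / a\<rfloor>"
    have n1: "real n \<le> s / a" "s / a < real n + 1"
      unfolding n_def using s0 a0 by (auto simp: of_nat_nat intro: floor_le_iff)
    have n2: "real n * a \<le> s" "s < (real n + 1) * a"
      using n1 a0 by (auto simp: field_simps)
    have "b / g + 1 \<le> s / a" using s a0 by (simp add: field_simps)
    then have "b / g \<le> real n" using n1 by linarith
    then have "b \<le> real n * g" using g(2) by (simp add: field_simps)
    then have mb: "real (Suc n) * b \<le> s" using n2(1) ab(3) by (simp add: algebra_simps)
    define j where "j = nat \<lfloor>(s - real (Suc n) * b) / g\<rfloor>"
    have j1: "real j \<le> (s - real (Suc n) * b) / g" "(s - real (Suc n) * b) / g < real j + 1"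
      unfolding j_def using mb g(2) by (auto simp: of_nat_nat intro: floor_le_iff)
    then have j2: "real j * g \<le> s - real (Suc n) * b" "s - real (Suc n) * b < (real j + 1) * g"
      using g(2) by (auto simp: field_simps)
    have "s - real (Suc n) * b < real (Suc n) * g"
      using n2(2) unfolding ab(3) by (simp add: algebra_simps)
    then have "real j * g < real (Suc n) * g" using j2(1) by linarith
    then have jn: "j < Suc n" using g(2) by simp
    have "real (Suc n - j) * b + real j * a \<in> semigroup_closure T"
      by (intro semigroup_closure_add semigroup_closure_multiple ab)
    moreover have "real (Suc n - j) * b + real j * a = real (Suc n) * b + real j * g"
      using jn unfolding ab(3) by (simp add: of_nat_diff algebra_simps)
    moreover have "\<bar>real (Suc n) * b + real j * g - s\<bar> < e"
      using j2 g(3) by (simp add: algebra_simps abs_if)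
    ultimately show ?thesis by metis
  qed
  with that show thesis by blast
qed

section \<open>A renewal inequality\<close>

lemma limit_superior_witness:
  fixes f :: "real \<Rightarrow> real"
  assumes up: "\<forall>\<^sub>F t in at_top. f t \<le> B" and lo: "\<forall>\<^sub>F t in at_top. 0 \<le> f t"
  obtains L x where "\<And>\<delta>. 0 < \<delta> \<Longrightarrow> \<forall>\<^sub>F t in at_top. f t < L + \<delta>"
    "filterlim x at_top sequentially" "\<And>\<delta>. 0 < \<delta> \<Longrightarrow> \<forall>\<^sub>F n in sequentially. L - \<delta> < f (x n)"
proof -
  define C where "C = {c. \<forall>\<^sub>F t in at_top. f t \<le> c}"
  define L where "L = Inf C"
  have ne: "C \<noteq> {}" using up by (auto simp: C_def)
  have bdd: "bdd_below C"
  proof (rule bdd_belowI[of _ 0])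
    fix c assume "c \<in> C"
    then have "\<forall>\<^sub>F t in at_top. f t \<le> c" by (simp add: C_def)
    with lo have "\<forall>\<^sub>F t::real in at_top. 0 \<le> c" by eventually_elim auto
    then show "0 \<le> c" by simp
  qed
  have A: "\<forall>\<^sub>F t in at_top. f t < L + \<delta>" if "0 < \<delta>" for \<delta>
  proof -
    obtain c where "c \<in> C" "c < L + \<delta>"
      using cInf_lessD[OF ne, of "L + \<delta>"] \<open>0 < \<delta>\<close> by (auto simp: L_def)
    then have "\<forall>\<^sub>F t in at_top. f t \<le> c" by (simp add: C_def)
    then show ?thesis by (rule eventually_mono) (use \<open>c < L + \<delta>\<close> in simp)
  qed
  have B: "\<exists>t\<ge>T. L - \<delta> < f t" if "0 < \<delta>" for \<delta> T
  proof (rule ccontr)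
    assume "\<not> ?thesis"
    then have "L - \<delta> \<in> C"
      unfolding C_def eventually_at_top_linorder by (auto simp: not_less)
    then have "L \<le> L - \<delta>" unfolding L_def using bdd by (rule cInf_lower)
    with that show False by simp
  qed
  have "\<forall>n. \<exists>t. t \<ge> real n \<and> L - 1 / real (Suc n) < f t" using B by simp
  then obtain x where x: "\<And>n. x n \<ge> real n" "\<And>n. L - 1 / real (Suc n) < f (x n)" by metis
  have 1: "filterlim x at_top sequentially"
    by (rule filterlim_at_top_mono[OF filterlim_real_sequentially]) (use x in auto)
  have 2: "\<forall>\<^sub>F n in sequentially. L - \<delta> < f (x n)" if "0 < \<delta>" for \<delta>
  proof -
    have "\<forall>\<^sub>F n in sequentially. 1 / real (Suc n) < \<delta>"
      using order_tendstoD(2)[OF LIMSEQ_inverse_real_of_nat that] by (simp add: inverse_eq_divide)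
    then show ?thesis by eventually_elim (use x(2) in \<open>smt (verit)\<close>)
  qed
  show thesis using that[OF A 1 2] .
qed

text \<open>
  Feller's proof of the renewal theorem via the Choquet--Deny principle, adapted to an inequality.
  With \<open>\<mu> = \<Sum> p\<^sub>i \<tau>\<^sub>i\<close> and \<open>L\<close> the upper limit of \<open>f\<close>, the decreasing quantity
  \<open>Q(t) = \<Sum> p\<^sub>i \<integral>\<^bsub>t-\<tau>\<^sub>i\<^esub>\<^bsup>t\<^esup> f\<close> is at least \<open>\<mu> L\<close> everywhere, which leaves no room for \<open>f\<close> to fall below
  \<open>L\<close> again.
\<close>

lemma renewal_inequality_limit:
  fixes f :: "real \<Rightarrow> real" and p \<tau> :: "'i \<Rightarrow> real"
  assumes fin: "finite I" and ne: "I \<noteq> {}"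
    and p: "\<And>i. i \<in> I \<Longrightarrow> 0 < p i" "(\<Sum>i\<in>I. p i) = 1"
    and \<tau>: "\<And>i. i \<in> I \<Longrightarrow> 0 < \<tau> i" "\<And>i. i \<in> I \<Longrightarrow> \<tau> i \<le> A"
    and dense: "\<And>e. 0 < e \<Longrightarrow> \<exists>S. \<forall>s\<ge>S. \<exists>g\<in>semigroup_closure (\<tau> ` I). \<bar>g - s\<bar> < e"
    and f: "\<And>t. 0 \<le> t \<Longrightarrow> 0 \<le> f t" "\<And>t. 0 \<le> t \<Longrightarrow> f t \<le> B"
    and ucont: "uniformly_continuous_on {0..} f"
    and ineq: "\<And>t. A \<le> t \<Longrightarrow> f t \<le> (\<Sum>i\<in>I. p i * f (t - \<tau> i))"
  shows "\<exists>L. (f \<longlongrightarrow> L) at_top"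
proof -
  have "\<forall>\<^sub>F t in at_top. f t \<le> B" "\<forall>\<^sub>F t in at_top. 0 \<le> f t"
    using eventually_ge_at_top[of 0] by (eventually_elim, use f in simp)+
  from limit_superior_witness[OF this] obtain L x where
    sup: "\<And>\<delta>. 0 < \<delta> \<Longrightarrow> \<forall>\<^sub>F t in at_top. f t < L + \<delta>"
    and xlim: "filterlim x at_top sequentially"
    and xL: "\<And>\<delta>. 0 < \<delta> \<Longrightarrow> \<forall>\<^sub>F n in sequentially. L - \<delta> < f (x n)" by blast
  have A0: "0 < A" using ne \<tau> by (metis all_not_in_conv less_le_trans)
  have shift: "filterlim (\<lambda>n. x n - s) at_top sequentially" for s
    using filterlim_tendsto_add_at_top[OF tendsto_const[of "- s"] xlim] by (simp add: add.commute)
  \<comment> \<open>An average that is nearly maximal has only nearly maximal terms.  Hence values close to \<open>L\<close>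
    spread backwards along all sums of steps.\<close>
  have propagate: "\<forall>\<delta>>0. \<forall>\<^sub>F n in sequentially. L - \<delta> < f (x n - g)"
    if "g \<in> semigroup_closure (\<tau> ` I)" for g
    using that
  proof induction
    case zero
    then show ?case using xL by simp
  next
    case (add g t)
    then obtain i where i: "i \<in> I" "t = \<tau> i" by auto
    show ?case
    proof (intro allI impI)
      fix \<delta> :: real assume "0 < \<delta>"
      \<comment> \<open>If all terms are below \<open>L + d\<close> and their average is above \<open>L - d\<close>, then the term of weight
      \<open>p i\<close> is above \<open>L - 2 * d / p i\<close>.\<close>
      define d where "d = p i * \<delta> / 2"
      have d: "0 < d" using \<open>0 < \<delta>\<close> p(1)[OF i(1)] by (simp add: d_def)
      have 1: "\<forall>\<^sub>F n in sequentially. L - d < f (x n - g)" using add.IH d by blast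
      have 2: "\<forall>\<^sub>F n in sequentially. \<forall>j\<in>I. f (x n - g - \<tau> j) < L + d"
      proof (intro eventually_ball_finite fin ballI)
        fix j
        have "\<forall>\<^sub>F n in sequentially. f (x n - (g + \<tau> j)) < L + d"
          using eventually_compose_filterlim[OF sup[OF d] shift] .
        then show "\<forall>\<^sub>F n in sequentially. f (x n - g - \<tau> j) < L + d" by (simp add: diff_diff_eq)
      qed
      have 3: "\<forall>\<^sub>F n in sequentially. A \<le> x n - g"
        using shift[of g] by (simp add: filterlim_at_top)
      show "\<forall>\<^sub>F n in sequentially. L - \<delta> < f (x n - (g + t))"
        using 1 2 3
      proof eventually_elim
        case (elim n)
        let ?y = "x n - g"
        have "L - d < (\<Sum>j\<in>I. p j * f (?y - \<tau> j))"
          using elim(1) ineq[OF elim(3)] by linarith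
        also have "\<dots> = p i * f (?y - \<tau> i) + (\<Sum>j\<in>I - {i}. p j * f (?y - \<tau> j))"
          using fin i(1) by (rule sum.remove)
        also have "(\<Sum>j\<in>I - {i}. p j * f (?y - \<tau> j)) \<le> (\<Sum>j\<in>I - {i}. p j * (L + d))"
          using elim(2) p(1) by (intro sum_mono mult_left_mono) (auto intro: less_imp_le)
        also have "\<dots> = (1 - p i) * (L + d)"
          using sum.remove[OF fin i(1), of p] p(2) by (simp add: sum_distrib_right[symmetric])
        finally have "p i * L - 2 * d + p i * d < p i * f (?y - \<tau> i)"
          by (simp add: algebra_simps)
        moreover have "0 < p i * d" using d p(1)[OF i(1)] by simp
        ultimately have "p i * (L - \<delta>) < p i * f (?y - \<tau> i)"
          by (simp add: d_def algebra_simps)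
        then show ?case using p(1)[OF i(1)] i(2) by (simp add: diff_diff_eq)
      qed
    qed
  qed
  define \<Phi> where "\<Phi> t = integral {0..t} f" for t
  have cont: "continuous_on {0..t} f" for t
    using uniformly_continuous_imp_continuous[OF ucont] by (rule continuous_on_subset) auto
  have deriv: "(\<Phi> has_real_derivative f t) (at t)" if "0 < t" for t
  proof -
    have "((\<lambda>u. integral {0..u} f) has_real_derivative f t) (at t within {0..t + 1})"
      by (rule integral_has_real_derivative[OF cont]) (use that in simp)
    moreover have "at t within {0..t + 1} = at t"
      using that by (intro at_within_interior) simp
    ultimately show ?thesis unfolding \<Phi>_def by simp
  qed
  have mean: "\<exists>z. u < z \<and> z < v \<and> \<Phi> v - \<Phi> u = (v - u) * f z" if "0 < u" "u < v" for u v
    using MVT2[OF that(2), of \<Phi> f] deriv that by auto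
  have mean_le: "\<Phi> v - \<Phi> u \<le> (v - u) * M"
    if "0 < u" "u \<le> v" "\<And>z. u \<le> z \<Longrightarrow> z \<le> v \<Longrightarrow> f z \<le> M" for u v M
  proof (cases "u = v")
    case False
    with mean[of u v] that show ?thesis
      by (metis diff_ge_0_iff_ge less_le mult_left_mono)
  qed simp
  have mean_ge: "(v - u) * M \<le> \<Phi> v - \<Phi> u"
    if "0 < u" "u \<le> v" "\<And>z. u \<le> z \<Longrightarrow> z \<le> v \<Longrightarrow> M \<le> f z" for u v M
  proof (cases "u = v")
    case False
    with mean[of u v] that show ?thesis
      by (metis diff_ge_0_iff_ge less_le mult_left_mono)
  qed simp
  define Q where "Q t = (\<Sum>i\<in>I. p i * (\<Phi> t - \<Phi> (t - \<tau> i)))" for t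
  define \<mu> where "\<mu> = (\<Sum>i\<in>I. p i * \<tau> i)"
  have \<mu>: "0 < \<mu>" unfolding \<mu>_def using fin ne p(1) \<tau>(1) by (intro sum_pos) auto
  have Qdec: "Q v \<le> Q u" if "A < u" "u \<le> v" for u v
  proof (rule DERIV_nonpos_imp_nonincreasing[OF that(2)])
    fix t assume t: "u \<le> t" "t \<le> v"
    have "(Q has_real_derivative (\<Sum>i\<in>I. p i * (f t - f (t - \<tau> i)))) (at t)"
      unfolding Q_def
    proof (intro DERIV_sum DERIV_cmult DERIV_diff deriv)
      show "0 < t" using t that A0 by linarith
      fix i assume i: "i \<in> I"
      have "(\<Phi> has_real_derivative f (t + - \<tau> i)) (at (t + - \<tau> i))"
        by (rule deriv) (use \<tau>[OF i] t that in linarith)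
      then show "((\<lambda>t. \<Phi> (t - \<tau> i)) has_real_derivative f (t - \<tau> i)) (at t)"
        using DERIV_shift[of \<Phi> "f (t - \<tau> i)" t "- \<tau> i"] by simp
    qed
    moreover have "(\<Sum>i\<in>I. p i * (f t - f (t - \<tau> i))) = f t - (\<Sum>i\<in>I. p i * f (t - \<tau> i))"
      using p(2) by (simp add: right_diff_distrib sum_subtractf sum_distrib_right[symmetric])
    moreover have "\<dots> \<le> 0" using ineq[of t] t that by simp
    ultimately show "\<exists>y. (Q has_real_derivative y) (at t) \<and> y \<le> 0" by auto
  qed
  \<comment> \<open>Far to the right there is a window of length \<open>A\<close> on which \<open>f\<close> is nearly \<open>L\<close>: finitely many sums
    of steps form a net of it, and uniform continuity fills the holes.\<close>
  have Qlow: "\<mu> * L \<le> Q t" if "A < t" for t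
  proof (rule field_le_epsilon)
    fix e :: real assume "0 < e"
    define \<delta> where "\<delta> = e / (2 * \<mu>)"
    have \<delta>: "0 < \<delta>" using \<open>0 < e\<close> \<mu> by (simp add: \<delta>_def)
    obtain \<eta> where \<eta>: "0 < \<eta>"
      "\<And>a b. 0 \<le> a \<Longrightarrow> 0 \<le> b \<Longrightarrow> \<bar>a - b\<bar> < \<eta> \<Longrightarrow> \<bar>f a - f b\<bar> < \<delta>"
      using ucont \<delta> unfolding uniformly_continuous_on_def dist_real_def by (metis atLeast_iff)
    obtain S where S: "\<And>s. S \<le> s \<Longrightarrow> \<exists>g\<in>semigroup_closure (\<tau> ` I). \<bar>g - s\<bar> < \<eta>"
      using dense[OF \<eta>(1)] by blast
    have cover: "{S..S + A} \<subseteq> (\<Union>g\<in>semigroup_closure (\<tau> ` I). ball g \<eta>)"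
      using S by (fastforce simp: dist_real_def)
    obtain C where C: "C \<subseteq> semigroup_closure (\<tau> ` I)" "finite C"
        "{S..S + A} \<subseteq> (\<Union>g\<in>C. ball g \<eta>)"
      by (rule compactE_image[OF compact_Icc _ cover]) auto
    have 1: "\<forall>\<^sub>F n in sequentially. \<forall>g\<in>C. L - \<delta> < f (x n - g)"
      using propagate C(1) \<delta> by (intro eventually_ball_finite C(2)) blast
    have "\<forall>\<^sub>F n in sequentially. 0 \<le> x n - g" for g
      using shift[of g] by (metis filterlim_at_top)
    then have 2: "\<forall>\<^sub>F n in sequentially. \<forall>g\<in>C. 0 \<le> x n - g"
      by (intro eventually_ball_finite C(2) ballI)
    have 3: "\<forall>\<^sub>F n in sequentially. A + t \<le> x n - S"
      using shift[of S] by (metis filterlim_at_top)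
    have "\<forall>\<^sub>F n in sequentially. \<mu> * (L - 2 * \<delta>) \<le> Q t"
      using 1 2 3
    proof eventually_elim
      case (elim n)
      have low: "L - 2 * \<delta> \<le> f z" if z: "x n - S - A \<le> z" "z \<le> x n - S" for z
      proof -
        obtain g where g: "g \<in> C" "\<bar>g - (x n - z)\<bar> < \<eta>"
        proof -
          have "x n - z \<in> {S..S + A}" using z by auto
          then have "x n - z \<in> (\<Union>g\<in>C. ball g \<eta>)" using C(3) by blast
          with that show ?thesis by (auto simp: dist_real_def)
        qed
        have "\<bar>f (x n - g) - f z\<bar> < \<delta>"
          by (rule \<eta>(2)) (use g elim(2,3) z that \<open>A < t\<close> A0 in \<open>auto simp: abs_if split: if_splits\<close>)
        with elim(1) g(1) show ?thesis by fastforce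
      qed
      have "\<mu> * (L - 2 * \<delta>) = (\<Sum>i\<in>I. p i * (\<tau> i * (L - 2 * \<delta>)))"
        by (simp add: \<mu>_def sum_distrib_right mult.assoc)
      also have "\<dots> \<le> Q (x n - S)"
        unfolding Q_def
      proof (intro sum_mono mult_left_mono)
        fix i assume i: "i \<in> I"
        show "0 \<le> p i" using p(1)[OF i] by simp
        show "\<tau> i * (L - 2 * \<delta>) \<le> \<Phi> (x n - S) - \<Phi> (x n - S - \<tau> i)"
          using mean_ge[of "x n - S - \<tau> i" "x n - S" "L - 2 * \<delta>"] low \<tau>[OF i] elim(3) \<open>A < t\<close> A0
          by simp
      qed
      also have "\<dots> \<le> Q t"
        using Qdec[OF \<open>A < t\<close>] elim(3) A0 by simp
      finally show ?case .
    qed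
    then have "\<mu> * (L - 2 * \<delta>) \<le> Q t" by simp
    moreover have "\<mu> * (L - 2 * \<delta>) = \<mu> * L - e" using \<mu> by (simp add: \<delta>_def field_simps)
    ultimately show "\<mu> * L \<le> Q t + e" by simp
  qed
  have "(f \<longlongrightarrow> L) at_top"
  proof (rule order_tendstoI)
    fix a assume "L < a"
    then show "\<forall>\<^sub>F t in at_top. f t < a" using sup[of "a - L"] by simp
  next
    fix a assume "a < L"
    define \<eta> where "\<eta> = (L - a) / 2"
    have \<eta>: "0 < \<eta>" using \<open>a < L\<close> by (simp add: \<eta>_def)
    obtain \<kappa>0 where \<kappa>0: "0 < \<kappa>0"
      "\<And>u v. 0 \<le> u \<Longrightarrow> 0 \<le> v \<Longrightarrow> \<bar>u - v\<bar> < \<kappa>0 \<Longrightarrow> \<bar>f u - f v\<bar> < \<eta>"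
      using ucont \<eta> unfolding uniformly_continuous_on_def dist_real_def by (metis atLeast_iff)
    define \<kappa> where "\<kappa> = min (\<kappa>0 / 2) (Min (\<tau> ` I))"
    have \<kappa>: "0 < \<kappa>" "\<kappa> < \<kappa>0" "\<And>i. i \<in> I \<Longrightarrow> \<kappa> \<le> \<tau> i"
      using \<kappa>0(1) fin ne \<tau>(1) by (auto simp: \<kappa>_def min.coboundedI2)
    \<comment> \<open>The excess \<open>\<mu> * \<delta>\<close> that \<open>f < L + \<delta>\<close> permits in \<open>Q\<close> is half of the deficit \<open>\<kappa> * \<eta>\<close> that a dip of
        width \<open>\<kappa>\<close> and depth \<open>\<eta>\<close> causes.\<close>
    define \<delta> where "\<delta> = \<kappa> * \<eta> / (2 * \<mu>)"
    have \<delta>: "0 < \<delta>" using \<kappa> \<eta> \<mu> by (simp add: \<delta>_def)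
    obtain T where T: "\<And>t. T \<le> t \<Longrightarrow> f t < L + \<delta>"
      using sup[OF \<delta>] unfolding eventually_at_top_linorder by blast
    have "\<forall>\<^sub>F t in at_top. max T 0 + A < t" by (rule eventually_gt_at_top)
    then show "\<forall>\<^sub>F t in at_top. a < f t"
    proof eventually_elim
      case (elim t)
      show "a < f t"
      proof (rule ccontr)
        assume "\<not> a < f t"
        then have ft: "f t \<le> L - 2 * \<eta>" by (simp add: \<eta>_def field_simps)
        have low: "f z \<le> L - \<eta>" if "t - \<kappa> \<le> z" "z \<le> t" for z
        proof -
          have "\<kappa> \<le> A" using \<kappa>(3) \<tau>(2) ne by fastforce
          then have "\<bar>f z - f t\<bar> < \<eta>"
            by (intro \<kappa>0(2)) (use that elim \<kappa> A0 in auto)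
          with ft show ?thesis by linarith
        qed
        have "Q t \<le> (\<Sum>i\<in>I. p i * (\<tau> i * (L + \<delta>) - \<kappa> * \<eta>))"
          unfolding Q_def
        proof (intro sum_mono mult_left_mono)
          fix i assume i: "i \<in> I"
          show "0 \<le> p i" using p(1)[OF i] by simp
          have "\<Phi> t - \<Phi> (t - \<kappa>) \<le> (t - (t - \<kappa>)) * (L - \<eta>)"
            by (rule mean_le) (use low elim \<kappa>(1) \<kappa>(3)[OF i] \<tau>[OF i] in auto)
          moreover have "\<Phi> (t - \<kappa>) - \<Phi> (t - \<tau> i) \<le> ((t - \<kappa>) - (t - \<tau> i)) * (L + \<delta>)"
            by (rule mean_le) (use T elim \<kappa>(1) \<kappa>(3)[OF i] \<tau>[OF i] in \<open>auto intro!: less_imp_le\<close>)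
          moreover have "0 < \<kappa> * \<delta>" using \<kappa> \<delta> by simp
          ultimately show "\<Phi> t - \<Phi> (t - \<tau> i) \<le> \<tau> i * (L + \<delta>) - \<kappa> * \<eta>"
            by (simp add: algebra_simps)
        qed
        also have "\<dots> = \<mu> * (L + \<delta>) - \<kappa> * \<eta>"
        proof -
          have "(\<Sum>i\<in>I. p i * (\<tau> i * (L + \<delta>))) = \<mu> * (L + \<delta>)"
            unfolding \<mu>_def sum_distrib_right by (simp add: mult.assoc)
          moreover have "(\<Sum>i\<in>I. p i * (\<kappa> * \<eta>)) = \<kappa> * \<eta>"
            using p(2) by (simp flip: sum_distrib_right)
          ultimately show ?thesis by (simp only: right_diff_distrib sum_subtractf)
        qed
        also have "\<dots> = \<mu> * L - \<kappa> * \<eta> / 2" using \<mu> by (simp add: \<delta>_def field_simps)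
        also have "\<dots> < \<mu> * L" using \<kappa> \<eta> by simp
        also have "\<mu> * L \<le> Q t" by (rule Qlow) (use elim in linarith)
        finally show False by simp
      qed
    qed
  qed
  then show ?thesis ..
qed

section \<open>Tubes and gaps of a compact set\<close>

text \<open>
  The sum of \<open>F\<close> and \<open>[0, \<delta>]\<close>.  It is a translate of the parallel set of radius \<open>\<delta> / 2\<close>, but it grows
  into each gap from one end only, which makes its growth easy to read off from the gaps.
\<close>

definition right_thickening :: "real set \<Rightarrow> real \<Rightarrow> real set" where
  "right_thickening F \<delta> = {x. \<exists>y\<in>F. y \<le> x \<and> x \<le> y + \<delta>}"

definition tube :: "real set \<Rightarrow> real \<Rightarrow> real" where
  "tube F \<delta> = measure lebesgue (right_thickening F \<delta>)"

text \<open>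
  The left end points of the gaps of length greater than \<open>\<delta>\<close>.  The maximum of \<open>F\<close>, where the
  unbounded gap starts, belongs to this set for every \<open>\<delta>\<close>.
\<close>

definition gap_starts :: "real set \<Rightarrow> real \<Rightarrow> real set" where
  "gap_starts F \<delta> = {y \<in> F. F \<inter> {y<..y + \<delta>} = {}}"

definition gaps_of_length :: "real set \<Rightarrow> real \<Rightarrow> real set" where
  "gaps_of_length F l = {y \<in> F. y + l \<in> F \<and> F \<inter> {y<..<y + l} = {}}"

lemma disjoint_packing:
  fixes T :: "real set"
  assumes "finite I" "T \<in> lmeasurable" "\<And>i. i \<in> I \<Longrightarrow> J i \<in> lmeasurable"
    and "disjoint_family_on J I" "\<And>i. i \<in> I \<Longrightarrow> J i \<subseteq> T" "\<And>i. i \<in> I \<Longrightarrow> m \<le> measure lebesgue (J i)"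
  shows "real (card I) * m \<le> measure lebesgue T"
proof -
  have "real (card I) * m \<le> (\<Sum>i\<in>I. measure lebesgue (J i))"
    using assms(6) sum_bounded_below[of I m "\<lambda>i. measure lebesgue (J i)"] by simp
  also have "\<dots> = measure lebesgue (\<Union>i\<in>I. J i)"
    using assms(1,3,4)
    by (intro measure_UNION'[symmetric]) (auto simp: disjoint_family_on_def pairwise_def disjnt_def)
  also have "\<dots> \<le> measure lebesgue T"
    using assms(1-3,5) by (intro measure_mono_fmeasurable) (auto intro: fmeasurableD)
  finally show ?thesis .
qed

lemma compact_right_thickening: "compact F \<Longrightarrow> compact (right_thickening F \<delta>)"
proof -
  assume "compact F"
  have "right_thickening F \<delta> = {x + y |x y. x \<in> F \<and> y \<in> {0..\<delta>}}"
  proof (intro set_eqI iffI)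
    fix z assume "z \<in> right_thickening F \<delta>"
    then obtain y where "y \<in> F" "y \<le> z" "z \<le> y + \<delta>" by (auto simp: right_thickening_def)
    then show "z \<in> {x + y |x y. x \<in> F \<and> y \<in> {0..\<delta>}}"
      by (intro CollectI exI[of _ y] exI[of _ "z - y"]) auto
  next
    fix z assume "z \<in> {x + y |x y. x \<in> F \<and> y \<in> {0..\<delta>}}"
    then obtain x y where "x \<in> F" "0 \<le> y" "y \<le> \<delta>" "z = x + y" by auto
    then show "z \<in> right_thickening F \<delta>"
      unfolding right_thickening_def by (intro CollectI bexI[of _ x]) auto
  qed
  then show ?thesis using compact_sums[OF \<open>compact F\<close> compact_Icc[of 0 \<delta>]] by simp
qed

lemma right_thickening_lmeasurable: "compact F \<Longrightarrow> right_thickening F \<delta> \<in> lmeasurable"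
  by (simp add: compact_right_thickening lmeasurable_compact)

lemma parallel_set_iff:
  assumes "compact F" "F \<noteq> {}"
  shows "x \<in> parallel_set F \<epsilon> \<longleftrightarrow> (\<exists>y\<in>F. \<bar>x - y\<bar> \<le> \<epsilon>)"
proof
  assume "x \<in> parallel_set F \<epsilon>"
  then have "infdist x F \<le> \<epsilon>" by (simp add: parallel_set_def)
  moreover obtain y where "y \<in> F" "infdist x F = dist x y"
    using infdist_attains_inf[OF compact_imp_closed[OF assms(1)] assms(2), of x] .
  ultimately show "\<exists>y\<in>F. \<bar>x - y\<bar> \<le> \<epsilon>"
    by (metis dist_real_def)
next
  assume "\<exists>y\<in>F. \<bar>x - y\<bar> \<le> \<epsilon>"
  then obtain y where "y \<in> F" "dist x y \<le> \<epsilon>" by (auto simp: dist_real_def)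
  then show "x \<in> parallel_set F \<epsilon>"
    unfolding parallel_set_def using infdist_le2 by blast
qed

lemma parallel_set_eq_thickening:
  assumes "compact F" "F \<noteq> {}"
  shows "parallel_set F \<epsilon> = (+) (- \<epsilon>) ` right_thickening F (2 * \<epsilon>)"
proof (intro set_eqI iffI)
  fix x assume "x \<in> parallel_set F \<epsilon>"
  then obtain y where "y \<in> F" "\<bar>x - y\<bar> \<le> \<epsilon>" using parallel_set_iff[OF assms] by blast
  then show "x \<in> (+) (- \<epsilon>) ` right_thickening F (2 * \<epsilon>)"
    by (intro image_eqI[of _ _ "x + \<epsilon>"]) (auto simp: right_thickening_def intro!: bexI[of _ y])
next
  fix x assume "x \<in> (+) (- \<epsilon>) ` right_thickening F (2 * \<epsilon>)"
  then obtain y where "y \<in> F" "y \<le> x + \<epsilon>" "x + \<epsilon> \<le> y + 2 * \<epsilon>"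
    by (auto simp: right_thickening_def)
  then show "x \<in> parallel_set F \<epsilon>"
    unfolding parallel_set_iff[OF assms] by (intro bexI[of _ y]) auto
qed

lemma compact_parallel_set:
  assumes "compact F" "F \<noteq> {}"
  shows "compact (parallel_set F \<epsilon>)"
  unfolding parallel_set_eq_thickening[OF assms]
  by (intro compact_translation compact_right_thickening assms)

lemma measure_parallel_set:
  assumes "compact F" "F \<noteq> {}"
  shows "measure lborel (parallel_set F \<epsilon>) = tube F (2 * \<epsilon>)"
proof -
  have "measure lborel (parallel_set F \<epsilon>) = measure lebesgue (parallel_set F \<epsilon>)"
    using compact_parallel_set[OF assms] by (simp add: measure_completion borel_compact)
  also have "\<dots> = tube F (2 * \<epsilon>)"
    unfolding tube_def parallel_set_eq_thickening[OF assms] by (rule measure_translation)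
  finally show ?thesis .
qed

lemma tube_mono: "compact F \<Longrightarrow> \<delta> \<le> \<delta>' \<Longrightarrow> tube F \<delta> \<le> tube F \<delta>'"
  unfolding tube_def
  by (intro measure_mono_fmeasurable fmeasurableD right_thickening_lmeasurable)
    (fastforce simp: right_thickening_def)

lemma card_separated_le_tube:
  assumes "compact F" "finite A" "A \<subseteq> F" "0 \<le> \<delta>"
    and sep: "\<And>a b. a \<in> A \<Longrightarrow> b \<in> A \<Longrightarrow> a < b \<Longrightarrow> \<delta> \<le> b - a"
  shows "real (card A) * \<delta> \<le> tube F \<delta>"
  unfolding tube_def
proof (rule disjoint_packing[where J = "\<lambda>a. {a<..<a + \<delta>}"])
  have "{a<..<a + \<delta>} \<inter> {b<..<b + \<delta>} = {}" if "a \<in> A" "b \<in> A" "a < b" for a b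
    using sep[OF that] by auto
  then show "disjoint_family_on (\<lambda>a. {a<..<a + \<delta>}) A"
    unfolding disjoint_family_on_def by (metis Int_commute linorder_neqE)
  show "{a<..<a + \<delta>} \<subseteq> right_thickening F \<delta>" if "a \<in> A" for a
  proof
    fix x assume "x \<in> {a<..<a + \<delta>}"
    then show "x \<in> right_thickening F \<delta>"
      unfolding right_thickening_def using that assms(3) by (intro CollectI bexI[of _ a]) auto
  qed
qed (use assms right_thickening_lmeasurable in auto)

lemma gap_starts_separated:
  "a \<in> gap_starts F \<delta> \<Longrightarrow> b \<in> gap_starts F \<delta> \<Longrightarrow> a < b \<Longrightarrow> \<delta> \<le> b - a"
  by (force simp: gap_starts_def)

lemma finite_gap_starts:
  assumes "compact F" "0 < \<delta>"
  shows "finite (gap_starts F \<delta>)"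
proof (rule finite_if_finite_subsets_card_bdd[THEN conjunct1])
  fix A assume A: "A \<subseteq> gap_starts F \<delta>" "finite A"
  have "A \<subseteq> F" using A by (auto simp: gap_starts_def)
  then have "real (card A) * \<delta> \<le> tube F \<delta>"
    using A assms by (intro card_separated_le_tube) (auto intro: gap_starts_separated)
  then have "real (card A) \<le> tube F \<delta> / \<delta>" using assms(2) by (simp add: field_simps)
  then show "card A \<le> nat \<lfloor>tube F \<delta> / \<delta>\<rfloor>" by (simp add: le_nat_floor)
qed

lemma gap_starts_antimono: "\<delta> \<le> \<delta>' \<Longrightarrow> gap_starts F \<delta>' \<subseteq> gap_starts F \<delta>"
  by (fastforce simp: gap_starts_def)

text \<open>
  When the thickness grows from \<open>\<delta>\<close> to \<open>\<delta> + h\<close>, each gap longer than \<open>\<delta> + h\<close> receives a new interval of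
  length \<open>h\<close>.
\<close>

lemma tube_increment_ge:
  assumes F: "compact F" and "0 \<le> \<delta>" "0 < h"
  shows "real (card (gap_starts F (\<delta> + h))) * h \<le> tube F (\<delta> + h) - tube F \<delta>"
proof -
  have sub: "right_thickening F \<delta> \<subseteq> right_thickening F (\<delta> + h)"
    using assms by (fastforce simp: right_thickening_def)
  have "real (card (gap_starts F (\<delta> + h))) * h
      \<le> measure lebesgue (right_thickening F (\<delta> + h) - right_thickening F \<delta>)"
  proof (rule disjoint_packing[where J = "\<lambda>y. {y + \<delta><..<y + \<delta> + h}"])
    show "finite (gap_starts F (\<delta> + h))" using assms by (intro finite_gap_starts) auto
    show "right_thickening F (\<delta> + h) - right_thickening F \<delta> \<in> lmeasurable"
      by (intro fmeasurable.Diff right_thickening_lmeasurable F)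
    have "{a + \<delta><..<a + \<delta> + h} \<inter> {b + \<delta><..<b + \<delta> + h} = {}"
      if "a \<in> gap_starts F (\<delta> + h)" "b \<in> gap_starts F (\<delta> + h)" "a < b" for a b
      using gap_starts_separated[OF that] assms by auto
    then show "disjoint_family_on (\<lambda>y. {y + \<delta><..<y + \<delta> + h}) (gap_starts F (\<delta> + h))"
      unfolding disjoint_family_on_def by (metis Int_commute linorder_neqE)
    show "{y + \<delta><..<y + \<delta> + h} \<subseteq> right_thickening F (\<delta> + h) - right_thickening F \<delta>"
      if "y \<in> gap_starts F (\<delta> + h)" for y
    proof
      fix x assume x: "x \<in> {y + \<delta><..<y + \<delta> + h}"
      have "x \<in> right_thickening F (\<delta> + h)"
        unfolding right_thickening_def using that x \<open>0 \<le> \<delta>\<close>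
        by (intro CollectI bexI[of _ y]) (auto simp: gap_starts_def)
      moreover have "x \<notin> right_thickening F \<delta>"
      proof
        assume "x \<in> right_thickening F \<delta>"
        then obtain z where z: "z \<in> F" "z \<le> x" "x \<le> z + \<delta>" by (auto simp: right_thickening_def)
        then have "z \<in> F \<inter> {y<..y + (\<delta> + h)}" using x by auto
        then show False using that by (auto simp: gap_starts_def)
      qed
      ultimately show "x \<in> right_thickening F (\<delta> + h) - right_thickening F \<delta>" by blast
    qed
  qed (use assms in auto)
  also have "\<dots> = tube F (\<delta> + h) - tube F \<delta>"
    unfolding tube_def using sub F
    by (intro measurable_measure_Diff right_thickening_lmeasurable fmeasurableD)
  finally show ?thesis .
qed

text \<open>
  Conversely, every new point lies within \<open>h\<close> of the right end of the piece \<open>[y, y + \<delta>]\<close>, where \<open>y\<close> is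
  the last point of \<open>F\<close> to its left, and \<open>y\<close> starts a gap longer than \<open>\<delta>\<close>.
\<close>

lemma tube_increment_le:
  assumes F: "compact F" and "0 < \<delta>" "0 \<le> h"
  shows "tube F (\<delta> + h) \<le> tube F \<delta> + real (card (gap_starts F \<delta>)) * h"
proof -
  let ?G = "gap_starts F \<delta>"
  have fin: "finite ?G" using assms by (intro finite_gap_starts)
  have sub: "right_thickening F (\<delta> + h) \<subseteq> right_thickening F \<delta> \<union> (\<Union>y\<in>?G. {y + \<delta>..y + \<delta> + h})"
  proof
    fix x assume "x \<in> right_thickening F (\<delta> + h)"
    then obtain z where z: "z \<in> F" "z \<le> x" "x \<le> z + \<delta> + h"
      by (auto simp: right_thickening_def)
    have "compact (F \<inter> {..x})" using F by (simp add: compact_Int_closed)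
    then obtain y where y: "y \<in> F \<inter> {..x}" "\<And>w. w \<in> F \<inter> {..x} \<Longrightarrow> w \<le> y"
      using compact_attains_sup[of "F \<inter> {..x}"] z by auto
    show "x \<in> right_thickening F \<delta> \<union> (\<Union>y\<in>?G. {y + \<delta>..y + \<delta> + h})"
    proof (cases "x \<le> y + \<delta>")
      case True
      then show ?thesis using y(1) by (auto simp: right_thickening_def)
    next
      case False
      have "y \<in> ?G" unfolding gap_starts_def using y False by fastforce
      moreover have "x \<le> y + \<delta> + h" using y(2)[of z] z by auto
      ultimately show ?thesis using False by fastforce
    qed
  qed
  have int: "(\<Union>y\<in>?G. {y + \<delta>..y + \<delta> + h}) \<in> lmeasurable"
    using fin by (intro fmeasurable.finite_UN) auto
  have "tube F (\<delta> + h) \<le> measure lebesgue (right_thickening F \<delta> \<union> (\<Union>y\<in>?G. {y + \<delta>..y + \<delta> + h}))"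
    unfolding tube_def using sub F int
    by (intro measure_mono_fmeasurable fmeasurableD fmeasurable.Un right_thickening_lmeasurable)
  also have "\<dots> \<le> tube F \<delta> + measure lebesgue (\<Union>y\<in>?G. {y + \<delta>..y + \<delta> + h})"
    unfolding tube_def using F int
    by (intro measure_Un_le fmeasurableD right_thickening_lmeasurable)
  also have "measure lebesgue (\<Union>y\<in>?G. {y + \<delta>..y + \<delta> + h})
      \<le> (\<Sum>y\<in>?G. measure lebesgue {y + \<delta>..y + \<delta> + h})"
    using fin by (intro measure_UNION_le) auto
  also have "\<dots> = real (card ?G) * h" using assms by simp
  finally show ?thesis by simp
qed

text \<open>
  The quotient of the tube measure by the thickness is decreasing: the growth rate is at most the
  number of gaps longer than \<open>\<delta>\<close>, and each of these contributes \<open>\<delta>\<close> to the tube.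
\<close>

lemma tube_scale_le:
  assumes F: "compact F" and "0 < \<delta>" "1 \<le> q"
  shows "tube F (q * \<delta>) \<le> q * tube F \<delta>"
proof -
  have "gap_starts F \<delta> \<subseteq> F" by (auto simp: gap_starts_def)
  then have "real (card (gap_starts F \<delta>)) * \<delta> \<le> tube F \<delta>"
    using assms finite_gap_starts[of F \<delta>]
    by (intro card_separated_le_tube) (auto intro: gap_starts_separated)
  then have "real (card (gap_starts F \<delta>)) * \<delta> * (q - 1) \<le> tube F \<delta> * (q - 1)"
    using assms by (intro mult_right_mono) auto
  moreover have "tube F (\<delta> + (q - 1) * \<delta>) \<le> tube F \<delta> + real (card (gap_starts F \<delta>)) * ((q - 1) * \<delta>)"
    using assms by (intro tube_increment_le) auto
  ultimately show ?thesis by (simp add: algebra_simps)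
qed

lemma powr_difference_quotient_limit:
  "((\<lambda>x::real. (x powr a - 1) / (x - 1)) \<longlongrightarrow> a) (at 1)"
proof -
  have "((\<lambda>x::real. x powr a) has_real_derivative a * 1 powr (a - 1)) (at 1)"
    by (rule has_real_derivative_powr) simp
  then show ?thesis by (simp add: has_field_derivative_iff)
qed

lemma filterlim_times_at_right_0:
  "0 < c \<Longrightarrow> filterlim (\<lambda>x::real. c * x) (at_right 0) (at_right 0)"
  unfolding filterlim_at
  by (auto intro!: tendsto_eq_intros eventually_mono[OF eventually_at_right_less[of 0]])

text \<open>
  A monotone density argument.  The gap count lies between the difference quotients of the tube
  measure over \<open>[\<delta>, x \<delta>]\<close> for \<open>x > 1\<close> and for \<open>x < 1\<close>.  After scaling, these tend to
  \<open>L (x\<^bsup>1-D\<^esup> - 1) / (x - 1)\<close> as \<open>\<delta>\<close> tends to zero, and to \<open>L (1 - D)\<close> as \<open>x\<close> then tends to 1.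
\<close>

lemma gap_count_asymptotics:
  assumes F: "compact F" 
    and lim: "((\<lambda>\<delta>. tube F \<delta> * \<delta> powr (D - 1)) \<longlongrightarrow> L) (at_right 0)"
  shows "((\<lambda>\<delta>. real (card (gap_starts F \<delta>)) * \<delta> powr D) \<longlongrightarrow> L * (1 - D)) (at_right 0)"
proof -
  define g where "g x = L * ((x powr (1 - D) - 1) / (x - 1))" for x
  have quotient: "((\<lambda>\<delta>. (tube F (x * \<delta>) - tube F \<delta>) * \<delta> powr (D - 1) / (x - 1)) \<longlongrightarrow> g x) (at_right 0)"
    if x: "0 < x" for x
  proof -
    have "((\<lambda>\<delta>. tube F (x * \<delta>) * (x * \<delta>) powr (D - 1)) \<longlongrightarrow> L) (at_right 0)"
      by (rule filterlim_compose[OF lim filterlim_times_at_right_0[OF x]])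
    then have "((\<lambda>\<delta>. (tube F (x * \<delta>) * (x * \<delta>) powr (D - 1) * x powr (1 - D)
        - tube F \<delta> * \<delta> powr (D - 1)) / (x - 1)) \<longlongrightarrow> (L * x powr (1 - D) - L) / (x - 1)) (at_right 0)"
      unfolding divide_inverse by (intro tendsto_intros lim)
    moreover have "(L * x powr (1 - D) - L) / (x - 1) = g x" by (simp add: g_def algebra_simps)
    moreover have "\<forall>\<^sub>F \<delta> in at_right 0. (tube F (x * \<delta>) * (x * \<delta>) powr (D - 1) * x powr (1 - D)
        - tube F \<delta> * \<delta> powr (D - 1)) / (x - 1)
        = (tube F (x * \<delta>) - tube F \<delta>) * \<delta> powr (D - 1) / (x - 1)"
      using eventually_at_right_less[of 0]
    proof eventually_elim
      case (elim \<delta>)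
      have "x powr (D - 1) * x powr (1 - D) = 1" using x by (simp flip: powr_add)
      then show ?case using elim x by (simp add: powr_mult algebra_simps)
    qed
    ultimately show ?thesis by (simp add: tendsto_cong)
  qed
  have "(g \<longlongrightarrow> L * (1 - D)) (at 1)"
    unfolding g_def by (intro tendsto_mult_left powr_difference_quotient_limit)
  then have gR: "(g \<longlongrightarrow> L * (1 - D)) (at_right 1)" and gL: "(g \<longlongrightarrow> L * (1 - D)) (at_left 1)"
    by (simp_all add: filterlim_at_split)
  show ?thesis
  proof (rule order_tendstoI)
    fix a assume a: "a < L * (1 - D)"
    obtain x where x: "1 < x" "a < g x"
      using eventually_happens[OF eventually_conj[OF order_tendstoD(1)[OF gR a] eventually_at_right_less[of 1]]]
      by auto
    have "\<forall>\<^sub>F \<delta> in at_right 0. a < (tube F (x * \<delta>) - tube F \<delta>) * \<delta> powr (D - 1) / (x - 1)"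
      using order_tendstoD(1)[OF quotient x(2)] x by simp
    then show "\<forall>\<^sub>F \<delta> in at_right 0. a < real (card (gap_starts F \<delta>)) * \<delta> powr D"
      using eventually_at_right_less[of 0]
    proof eventually_elim
      case (elim \<delta>)
      have "tube F (\<delta> + (x - 1) * \<delta>) \<le> tube F \<delta> + real (card (gap_starts F \<delta>)) * ((x - 1) * \<delta>)"
        using F elim x by (intro tube_increment_le) auto
      then have "tube F (x * \<delta>) - tube F \<delta> \<le> real (card (gap_starts F \<delta>)) * ((x - 1) * \<delta>)"
        by (simp add: algebra_simps)
      then have "(tube F (x * \<delta>) - tube F \<delta>) * \<delta> powr (D - 1) / (x - 1)
          \<le> real (card (gap_starts F \<delta>)) * ((x - 1) * \<delta>) * \<delta> powr (D - 1) / (x - 1)"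
        using x by (intro divide_right_mono mult_right_mono) auto
      also have "\<dots> = real (card (gap_starts F \<delta>)) * (\<delta> * \<delta> powr (D - 1))" using x by simp
      also have "\<delta> * \<delta> powr (D - 1) = \<delta> powr D" using elim by (simp add: powr_mult_base)
      finally show ?case using elim by linarith
    qed
  next
    fix a assume a: "L * (1 - D) < a"
    have "\<forall>\<^sub>F x in at_left 1. (0::real) < x" by (rule eventually_at_leftI[of 0]) auto
    from eventually_conj[OF order_tendstoD(2)[OF gL a] eventually_conj[OF this eventually_at_leftI[of 0 1 "\<lambda>x. x < 1"]]]
    obtain x where x: "0 < x" "x < 1" "g x < a"
      using eventually_happens[of _ "at_left (1::real)"] by auto
    have "\<forall>\<^sub>F \<delta> in at_right 0. (tube F (x * \<delta>) - tube F \<delta>) * \<delta> powr (D - 1) / (x - 1) < a"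
      using order_tendstoD(2)[OF quotient x(3)] x by simp
    then show "\<forall>\<^sub>F \<delta> in at_right 0. real (card (gap_starts F \<delta>)) * \<delta> powr D < a"
      using eventually_at_right_less[of 0]
    proof eventually_elim
      case (elim \<delta>)
      have "real (card (gap_starts F (x * \<delta> + (1 - x) * \<delta>))) * ((1 - x) * \<delta>)
          \<le> tube F (x * \<delta> + (1 - x) * \<delta>) - tube F (x * \<delta>)"
        using F elim x by (intro tube_increment_ge) auto
      moreover have "x * \<delta> + (1 - x) * \<delta> = \<delta>" by (simp add: algebra_simps)
      ultimately have "real (card (gap_starts F \<delta>)) * ((1 - x) * \<delta>) \<le> tube F \<delta> - tube F (x * \<delta>)"
        by simp
      then have "real (card (gap_starts F \<delta>)) * ((1 - x) * \<delta>) * \<delta> powr (D - 1) / (1 - x)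
          \<le> (tube F \<delta> - tube F (x * \<delta>)) * \<delta> powr (D - 1) / (1 - x)"
        using x by (intro divide_right_mono mult_right_mono) auto
      also have "\<dots> = (tube F (x * \<delta>) - tube F \<delta>) * \<delta> powr (D - 1) / (x - 1)"
        using x by (simp add: field_simps)
      also have "\<dots> < a" by (rule elim)
      finally have "real (card (gap_starts F \<delta>)) * (\<delta> * \<delta> powr (D - 1)) < a" using x by simp
      moreover have "\<delta> * \<delta> powr (D - 1) = \<delta> powr D" using elim by (simp add: powr_mult_base)
      ultimately show ?case by simp
    qed
  qed
qed

text \<open>
  The gaps of length \<open>l\<close> are among those counted at \<open>\<theta> l\<close> but not at \<open>l\<close>, for each \<open>\<theta> < 1\<close>.  After
  multiplication by \<open>l\<^sup>D\<close> the difference of these counts tends to \<open>C (\<theta>\<^bsup>-D\<^esup> - 1)\<close>, which is small for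
  \<open>\<theta>\<close> close to 1.
\<close>

lemma few_gaps_of_equal_length:
  assumes F: "compact F"
    and lim: "((\<lambda>\<delta>. real (card (gap_starts F \<delta>)) * \<delta> powr D) \<longlongrightarrow> C) (at_right 0)"
  shows "((\<lambda>l. real (card (gaps_of_length F l)) * l powr D) \<longlongrightarrow> 0) (at_right 0)"
proof (rule order_tendstoI)
  fix a :: real assume "a < 0"
  show "\<forall>\<^sub>F l in at_right 0. a < real (card (gaps_of_length F l)) * l powr D"
    using \<open>a < 0\<close> by (intro always_eventually allI) (rule less_le_trans, auto)
next
  fix a :: real assume a: "0 < a"
  have "((\<lambda>\<theta>. C * \<theta> powr (- D) - C) \<longlongrightarrow> C * 1 powr (- D) - C) (at_left 1)"
    by (intro tendsto_intros) auto
  then have "\<forall>\<^sub>F \<theta> in at_left 1. C * \<theta> powr (- D) - C < a"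
    using order_tendstoD(2)[of _ _ _ a] a by force
  moreover have "\<forall>\<^sub>F \<theta> in at_left 1. (0::real) < \<theta>" by (rule eventually_at_leftI[of 0]) auto
  moreover have "\<forall>\<^sub>F \<theta> in at_left 1. (\<theta>::real) < 1" by (rule eventually_at_leftI[of 0]) auto
  ultimately have "\<forall>\<^sub>F \<theta> in at_left 1. 0 < \<theta> \<and> \<theta> < 1 \<and> C * \<theta> powr (- D) - C < a"
    by eventually_elim auto
  then obtain \<theta> where \<theta>: "0 < \<theta>" "\<theta> < 1" "C * \<theta> powr (- D) - C < a"
    using eventually_happens[of _ "at_left (1::real)"] by auto
  have "((\<lambda>l. real (card (gap_starts F (\<theta> * l))) * (\<theta> * l) powr D * \<theta> powr (- D)
      - real (card (gap_starts F l)) * l powr D) \<longlongrightarrow> C * \<theta> powr (- D) - C) (at_right 0)"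
    by (intro tendsto_intros lim filterlim_compose[OF lim filterlim_times_at_right_0[OF \<theta>(1)]])
  from order_tendstoD(2)[OF this \<theta>(3)] eventually_at_right_less[of 0]
  show "\<forall>\<^sub>F l in at_right 0. real (card (gaps_of_length F l)) * l powr D < a"
  proof eventually_elim
    case (elim l)
    have l: "\<theta> * l < l" "0 < \<theta> * l" using elim \<theta> by auto
    have "gaps_of_length F l \<subseteq> gap_starts F (\<theta> * l) - gap_starts F l"
      using elim l by (fastforce simp: gaps_of_length_def gap_starts_def)
    then have "card (gaps_of_length F l) \<le> card (gap_starts F (\<theta> * l) - gap_starts F l)"
      using F l by (intro card_mono) (auto intro: finite_gap_starts)
    also have "\<dots> = card (gap_starts F (\<theta> * l)) - card (gap_starts F l)"
      using F l elim by (intro card_Diff_subset finite_gap_starts gap_starts_antimono) auto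
    finally have "real (card (gaps_of_length F l))
        \<le> real (card (gap_starts F (\<theta> * l))) - real (card (gap_starts F l))"
      using card_mono[OF finite_gap_starts[OF F l(2)] gap_starts_antimono[of "\<theta> * l" l F]] l by linarith
    then have "real (card (gaps_of_length F l)) * l powr D
        \<le> (real (card (gap_starts F (\<theta> * l))) - real (card (gap_starts F l))) * l powr D"
      by (intro mult_right_mono) auto
    moreover have "(\<theta> * l) powr D * \<theta> powr (- D) = l powr D"
      using \<theta>(1) elim by (simp add: powr_mult powr_minus)
    then have "real (card (gap_starts F (\<theta> * l))) * (\<theta> * l) powr D * \<theta> powr (- D)
        = real (card (gap_starts F (\<theta> * l))) * l powr D"
      by (simp only: mult.assoc)
    ultimately show ?case using elim(1) unfolding left_diff_distrib by linarith
  qed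
qed

lemma gap_start_has_end:
  assumes F: "compact F" and y: "y \<in> gap_starts F \<delta>" "y \<notin> gap_starts F \<delta>'" and "0 < \<delta>"
  obtains l where "\<delta> < l" "l \<le> \<delta>'" "y \<in> gaps_of_length F l"
proof -
  have yF: "y \<in> F" and free: "F \<inter> {y<..y + \<delta>} = {}" using y(1) by (auto simp: gap_starts_def)
  have beyond: "y + \<delta> < z" if "z \<in> F" "y < z" for z
  proof (rule ccontr)
    assume "\<not> y + \<delta> < z"
    then have "z \<in> F \<inter> {y<..y + \<delta>}" using that by auto
    with free show False by blast
  qed
  obtain z where z: "z \<in> F" "y < z" "z \<le> y + \<delta>'" using y(2) yF by (auto simp: gap_starts_def)
  let ?K = "F \<inter> {y + \<delta>..y + \<delta>'}"
  have "compact ?K" using F by (intro compact_Int_closed) auto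
  moreover have "z \<in> ?K" using z beyond[of z] by auto
  then have "?K \<noteq> {}" by blast
  ultimately have "\<exists>x\<in>?K. \<forall>w\<in>?K. x \<le> w" by (rule compact_attains_inf)
  then obtain x where x: "x \<in> ?K" "\<And>w. w \<in> ?K \<Longrightarrow> x \<le> w" by metis
  have "F \<inter> {y<..<x} = {}"
  proof (rule ccontr)
    assume "F \<inter> {y<..<x} \<noteq> {}"
    then obtain w where w: "w \<in> F" "y < w" "w < x" by auto
    then have "w \<in> ?K" using beyond[of w] x(1) by auto
    then show False using x(2) w by force
  qed
  then have "y \<in> gaps_of_length F (x - y)" using x(1) yF by (simp add: gaps_of_length_def)
  moreover have "\<delta> < x - y" using beyond[of x] x(1) \<open>0 < \<delta>\<close> by auto
  ultimately show thesis using that[of "x - y"] x(1) by auto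
qed

section \<open>Similarities of the line\<close>

text \<open>
  The distances to the images of \<open>0\<close> and \<open>1\<close> determine a point of the line.
\<close>

lemma similarity_affine:
  fixes f :: "real \<Rightarrow> real"
  assumes "\<And>x y. \<bar>f x - f y\<bar> = \<rho> * \<bar>x - y\<bar>"
  obtains m c where "\<bar>m\<bar> = \<rho>" "f = (\<lambda>x. m *\<^sub>R x + c)"
proof -
  define m where "m = f 1 - f 0"
  have m: "\<bar>m\<bar> = \<rho>" using assms[of 1 0] by (simp add: m_def)
  have "f x = m * x + f 0" for x
  proof -
    have "\<bar>f x - f 0\<bar> = \<bar>m * x\<bar>" "\<bar>f x - f 0 - m\<bar> = \<bar>m * (x - 1)\<bar>"
      using assms[of x 0] assms[of x 1] m by (simp_all add: m_def abs_mult)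
    then have "(f x - f 0)\<^sup>2 = (m * x)\<^sup>2" "(f x - f 0 - m)\<^sup>2 = (m * (x - 1))\<^sup>2"
      by (metis power2_abs)+
    then have "2 * (m * (f x - f 0 - m * x)) = 0"
      by algebra
    then show ?thesis using assms[of x 0] m by (cases "m = 0") simp_all
  qed
  then have "f = (\<lambda>x. m *\<^sub>R x + f 0)" unfolding real_scaleR_def by (rule ext)
  with m show thesis by (rule that)
qed

lemma measure_similarity_image:
  fixes f :: "real \<Rightarrow> real"
  assumes "\<And>x y. \<bar>f x - f y\<bar> = \<rho> * \<bar>x - y\<bar>"
  shows "measure lebesgue (f ` S) = \<rho> * measure lebesgue S"
proof -
  obtain m c where "\<bar>m\<bar> = \<rho>" "f = (\<lambda>x. m *\<^sub>R x + c)" using similarity_affine[OF assms] .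
  then show ?thesis using measure_lebesgue_affine[of m c S] by simp
qed

lemma compact_similarity_image:
  fixes f :: "real \<Rightarrow> real"
  assumes "\<And>x y. \<bar>f x - f y\<bar> = \<rho> * \<bar>x - y\<bar>" "compact S"
  shows "compact (f ` S)"
proof -
  obtain m c where "f = (\<lambda>x. m *\<^sub>R x + c)" using similarity_affine[OF assms(1)] .
  then have "continuous_on S f" by (simp add: continuous_intros)
  then show ?thesis using assms(2) by (rule compact_continuous_image)
qed

lemma tube_similarity_image:
  fixes f :: "real \<Rightarrow> real"
  assumes f: "\<And>x y. \<bar>f x - f y\<bar> = \<rho> * \<bar>x - y\<bar>" and "0 < \<rho>" and F: "compact F" "F \<noteq> {}"
  shows "tube (f ` F) (\<rho> * \<delta>) = \<rho> * tube F \<delta>"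
proof -
  obtain m c where m: "\<bar>m\<bar> = \<rho>" "f = (\<lambda>x. m *\<^sub>R x + c)" using similarity_affine[OF f] .
  have surj: "\<exists>z. x = f z" for x
    by (rule exI[of _ "(x - c) / m"]) (use m \<open>0 < \<rho>\<close> in auto)
  have fF: "compact (f ` F)" "f ` F \<noteq> {}" using compact_similarity_image[OF f] F by auto
  have "parallel_set (f ` F) (\<rho> * (\<delta> / 2)) = f ` parallel_set F (\<delta> / 2)"
  proof -
    have "f z \<in> parallel_set (f ` F) (\<rho> * (\<delta> / 2)) \<longleftrightarrow> z \<in> parallel_set F (\<delta> / 2)" for z
      using \<open>0 < \<rho>\<close> by (simp add: parallel_set_iff[OF fF] parallel_set_iff[OF F] f)
    note iff = this
    show ?thesis
    proof (intro subset_antisym subsetI)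
      fix x assume x: "x \<in> parallel_set (f ` F) (\<rho> * (\<delta> / 2))"
      obtain z where "x = f z" using surj by blast
      with x iff show "x \<in> f ` parallel_set F (\<delta> / 2)" by blast
    qed (use iff in blast)
  qed
  then have "measure lebesgue (parallel_set (f ` F) (\<rho> * (\<delta> / 2))) = \<rho> * measure lebesgue (parallel_set F (\<delta> / 2))"
    using measure_similarity_image[OF f] by simp
  then show ?thesis
    using measure_parallel_set[OF fF, of "\<rho> * (\<delta> / 2)"] measure_parallel_set[OF F, of "\<delta> / 2"]
      compact_parallel_set[OF fF, of "\<rho> * (\<delta> / 2)"] compact_parallel_set[OF F, of "\<delta> / 2"]
    by (simp add: measure_completion borel_compact)
qed

section \<open>Words and cylinders of a self-similar system\<close>

text \<open>
  The function \<open>x \<mapsto> \<Sum> r\<^sub>i\<^sup>x\<close> is continuous, equals \<open>N \<ge> 2\<close> at \<open>0\<close> and tends to \<open>0\<close>.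
\<close>

lemma similarity_dimension_exists:
  fixes r :: "nat \<Rightarrow> real"
  assumes "2 \<le> N" and r: "\<And>i. i \<in> {1..N} \<Longrightarrow> 0 < r i \<and> r i < 1"
  obtains D where "0 < D" "(\<Sum>i\<in>{1..N}. r i powr D) = 1"
proof -
  define g where "g x = (\<Sum>i\<in>{1..N}. r i powr x)" for x :: real
  have g0: "g 0 = real N" unfolding g_def using r by (simp add: less_imp_neq[THEN not_sym])
  have "(g \<longlongrightarrow> (\<Sum>i\<in>{1..N}. 0)) at_top"
    unfolding g_def
  proof (intro tendsto_sum)
    fix i assume "i \<in> {1..N}"
    with r have "0 < r i" "r i < 1" by auto
    then show "((\<lambda>x. r i powr x) \<longlongrightarrow> 0) at_top" by real_asymp
  qed
  then have "\<forall>\<^sub>F x in at_top. g x < 1 \<and> 0 \<le> x"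
    using order_tendstoD(2)[of g 0 at_top 1] eventually_ge_at_top[of 0] by (simp add: eventually_conj_iff)
  then obtain b where b: "g b < 1" "0 \<le> b" 
    using eventually_happens'[OF trivial_limit_at_top_linorder] by blast
  have "\<exists>x\<ge>0. x \<le> b \<and> g x = 1"
  proof (rule IVT2')
    show "continuous_on {0..b} g"
      unfolding g_def using r by (intro continuous_intros) (auto simp: less_imp_neq[THEN not_sym])
  qed (use b g0 assms(1) in auto)
  then obtain x where x: "0 \<le> x" "g x = 1" by blast
  then have "x \<noteq> 0" using g0 assms(1) by auto
  with x that[of x] show thesis by (simp add: g_def)
qed

locale similarity_system =
  fixes N :: nat and \<phi> :: "nat \<Rightarrow> real \<Rightarrow> real" and r :: "nat \<Rightarrow> real" and F :: "real set" and D :: real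
  assumes N: "1 \<le> N"
    and similarities: "contracting_similarities N \<phi> r"
    and generates: "generates_self_similar_set N \<phi> F"
    and D_pos: "0 < D"
    and Moran: "(\<Sum>i\<in>{1..N}. r i powr D) = 1"
begin

lemma F_compact: "compact F" and F_nonempty: "F \<noteq> {}" and F_eq: "F = (\<Union>i\<in>{1..N}. \<phi> i ` F)"
  using generates by (auto simp: generates_self_similar_set_def)

lemma r_bounds: "i \<in> {1..N} \<Longrightarrow> 0 < r i" "i \<in> {1..N} \<Longrightarrow> r i < 1"
  using similarities by (auto simp: contracting_similarities_def)

lemma map_dist: "i \<in> {1..N} \<Longrightarrow> \<bar>\<phi> i x - \<phi> i y\<bar> = r i * \<bar>x - y\<bar>"
  using similarities by (auto simp: contracting_similarities_def dist_real_def)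

definition rmin :: real where "rmin = Min (r ` {1..N})"

lemma rmin: "0 < rmin" "rmin < 1" "i \<in> {1..N} \<Longrightarrow> rmin \<le> r i"
proof -
  have "rmin \<in> r ` {1..N}" unfolding rmin_def using N by (intro Min_in) auto
  then show "0 < rmin" "rmin < 1" using r_bounds by auto
qed (simp add: rmin_def)

definition words :: "nat list set" where "words = lists {1..N}"

definition ratio :: "nat list \<Rightarrow> real" where "ratio u = prod_list (map r u)"

definition cyl :: "nat list \<Rightarrow> real set" where "cyl u = foldr \<phi> u ` F"

lemma words_simps [simp]: "[] \<in> words" "i # u \<in> words \<longleftrightarrow> i \<in> {1..N} \<and> u \<in> words"
  "u @ v \<in> words \<longleftrightarrow> u \<in> words \<and> v \<in> words"
  by (auto simp: words_def)

lemma ratio_simps [simp]: "ratio [] = 1" "ratio (i # u) = r i * ratio u"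
  "ratio (u @ v) = ratio u * ratio v"
  by (simp_all add: ratio_def)

lemma ratio_pos: "u \<in> words \<Longrightarrow> 0 < ratio u"
  by (induction u) (auto intro!: mult_pos_pos r_bounds)

lemma ratio_le_1: "u \<in> words \<Longrightarrow> ratio u \<le> 1"
proof (induction u)
  case (Cons i u)
  then show ?case using r_bounds[of i] ratio_pos[of u] by (auto intro!: mult_le_one)
qed simp

lemma word_dist: "u \<in> words \<Longrightarrow> \<bar>foldr \<phi> u x - foldr \<phi> u y\<bar> = ratio u * \<bar>x - y\<bar>"
  by (induction u) (auto simp: map_dist)

lemma cyl_Nil [simp]: "cyl [] = F"
  by (simp add: cyl_def)

lemma cyl_append: "cyl (u @ v) = foldr \<phi> u ` cyl v"
  by (simp add: cyl_def image_image)

lemma cyl_subset: "u \<in> words \<Longrightarrow> cyl u \<subseteq> F"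
proof (induction u)
  case (Cons i u)
  have "cyl (i # u) = \<phi> i ` cyl u" by (simp add: cyl_def image_image)
  also have "\<dots> \<subseteq> \<phi> i ` F" using Cons by (intro image_mono) simp
  also have "\<dots> \<subseteq> (\<Union>i\<in>{1..N}. \<phi> i ` F)" using Cons.prems by auto
  also have "\<dots> = F" using F_eq by (rule sym)
  finally show ?case .
qed simp

lemma cyl_append_subset: "u \<in> words \<Longrightarrow> v \<in> words \<Longrightarrow> cyl (u @ v) \<subseteq> cyl u"
  unfolding cyl_append using image_mono[OF cyl_subset[of v], of "foldr \<phi> u"] by (simp add: cyl_def)

text \<open>
  The words at which the ratio first drops to \<open>s\<close> or below.  For \<open>0 < s \<le> 1\<close> their cylinders cover
  \<open>F\<close> and all have size about \<open>s\<close>.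
\<close>

definition stopped :: "real \<Rightarrow> nat list set" where
  "stopped s = {u \<in> words. ratio u \<le> s \<and> (u = [] \<or> s < ratio (butlast u))}"

lemma stopped_words: "u \<in> stopped s \<Longrightarrow> u \<in> words"
  by (simp add: stopped_def)

lemma stopped_large:
  assumes "1 \<le> s"
  shows "stopped s = {[]}"
proof -
  have "ratio (butlast u) \<le> s" if "u \<in> words" for u
    using that ratio_le_1[of "butlast u"] assms
    by (auto simp: words_def intro: order_trans dest: in_set_butlastD)
  then have "u = []" if "u \<in> stopped s" for u
    using that by (force simp: stopped_def dest: leD)
  moreover have "[] \<in> stopped s" using assms by (simp add: stopped_def)
  ultimately show ?thesis by blast
qed

lemma Cons_stopped_iff:
  assumes "s < 1"
  shows "i # u \<in> stopped s \<longleftrightarrow> i \<in> {1..N} \<and> u \<in> stopped (s / r i)"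
  using r_bounds[of i] assms by (auto simp: stopped_def field_simps)

lemma stopped_small:
  assumes "s < 1"
  shows "stopped s = (\<Union>i\<in>{1..N}. (#) i ` stopped (s / r i))"
proof (intro set_eqI)
  fix u
  show "u \<in> stopped s \<longleftrightarrow> u \<in> (\<Union>i\<in>{1..N}. (#) i ` stopped (s / r i))"
  proof (cases u)
    case Nil
    then show ?thesis using assms by (auto simp: stopped_def)
  next
    case (Cons i v)
    then show ?thesis using Cons_stopped_iff[OF assms, of i v] by auto
  qed
qed

text \<open>
  Passing from \<open>s\<close> to \<open>s / r i\<close> increases the scale by a factor bounded away from 1, so the scale 1 is
  reached after finitely many steps.
\<close>

lemma scale_induct [consumes 1, case_names large small]:
  assumes "0 < s"
    and large: "\<And>s. 1 \<le> s \<Longrightarrow> P s"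
    and small: "\<And>s. \<lbrakk>0 < s; s < 1; \<And>i. i \<in> {1..N} \<Longrightarrow> P (s / r i)\<rbrakk> \<Longrightarrow> P s"
  shows "P s"
proof -
  define q where "q = Max (r ` {1..N})"
  have "q \<in> r ` {1..N}" unfolding q_def using N by (intro Max_in) auto
  then have q: "0 < q" "q < 1" using r_bounds by auto
  have rq: "r i \<le> q" if "i \<in> {1..N}" for i using that by (simp add: q_def)
  have "\<forall>s. 0 < s \<longrightarrow> q ^ n \<le> s \<longrightarrow> P s" for n
  proof (induction n)
    case 0
    then show ?case using large by simp
  next
    case (Suc n)
    show ?case
    proof (intro allI impI)
      fix s assume s: "0 < s" "q ^ Suc n \<le> s"
      show "P s"
      proof (cases "1 \<le> s")
        case False
        show ?thesis
        proof (rule small)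
          fix i assume i: "i \<in> {1..N}"
          have "q ^ n * r i \<le> q ^ n * q" using rq[OF i] q by (intro mult_left_mono) auto
          also have "\<dots> \<le> s" using s by (simp add: mult.commute)
          finally have "q ^ n \<le> s / r i" using r_bounds[OF i] by (simp add: field_simps)
          then show "P (s / r i)" using Suc s r_bounds[OF i] by simp
        qed (use s False in auto)
      qed (rule large)
    qed
  qed
  moreover obtain n where "q ^ n < s" using real_arch_pow_inv[OF \<open>0 < s\<close> q(2)] by blast
  ultimately show ?thesis using \<open>0 < s\<close> by (meson less_imp_le)
qed

lemma finite_stopped: "0 < s \<Longrightarrow> finite (stopped s)"
  by (induction s rule: scale_induct) (simp_all add: stopped_large stopped_small)

lemma sum_stopped: "0 < s \<Longrightarrow> (\<Sum>u\<in>stopped s. ratio u powr D) = 1"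
proof (induction s rule: scale_induct)
  case (large s)
  then show ?case by (simp add: stopped_large)
next
  case (small s)
  have pos: "0 < s / r i" if "i \<in> {1..N}" for i using small(1) r_bounds[OF that] by simp
  have "(\<Sum>u\<in>stopped s. ratio u powr D) = (\<Sum>i\<in>{1..N}. \<Sum>u\<in>(#) i ` stopped (s / r i). ratio u powr D)"
    unfolding stopped_small[OF small(2)] using finite_stopped[OF pos]
    by (intro sum.UNION_disjoint) auto
  also have "\<dots> = (\<Sum>i\<in>{1..N}. r i powr D * (\<Sum>u\<in>stopped (s / r i). ratio u powr D))"
  proof (rule sum.cong[OF refl])
    fix i assume i: "i \<in> {1..N}"
    have "(\<Sum>u\<in>(#) i ` stopped (s / r i). ratio u powr D) = (\<Sum>u\<in>stopped (s / r i). ratio (i # u) powr D)"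
      by (subst sum.reindex) auto
    also have "\<dots> = (\<Sum>u\<in>stopped (s / r i). r i powr D * ratio u powr D)"
      using r_bounds[OF i] ratio_pos stopped_words
      by (intro sum.cong refl) (simp add: powr_mult less_imp_le)
    finally show "(\<Sum>u\<in>(#) i ` stopped (s / r i). ratio u powr D)
        = r i powr D * (\<Sum>u\<in>stopped (s / r i). ratio u powr D)"
      by (simp add: sum_distrib_left)
  qed
  also have "\<dots> = (\<Sum>i\<in>{1..N}. r i powr D)" using small(3) by (intro sum.cong) auto
  finally show ?case using Moran by simp
qed

lemma stopped_cover: "0 < s \<Longrightarrow> F \<subseteq> (\<Union>u\<in>stopped s. cyl u)"
proof (induction s rule: scale_induct)
  case (large s)
  then show ?case by (simp add: stopped_large)
next
  case (small s)
  show ?case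
  proof
    fix x assume "x \<in> F"
    then obtain i y where i: "i \<in> {1..N}" "y \<in> F" "x = \<phi> i y" using F_eq by blast
    then obtain u where "u \<in> stopped (s / r i)" "y \<in> cyl u" using small(3) by blast
    then have "i # u \<in> stopped s" "x \<in> cyl (i # u)"
      using i Cons_stopped_iff[OF small(2)] by (auto simp: cyl_def)
    then show "x \<in> (\<Union>u\<in>stopped s. cyl u)" by blast
  qed
qed

lemma stopped_ratio_le: "u \<in> stopped s \<Longrightarrow> ratio u \<le> s"
  by (simp add: stopped_def)

lemma stopped_ratio_ge:
  assumes "u \<in> stopped s" "s \<le> 1"
  shows "rmin * s \<le> ratio u"
proof (cases "u = []")
  case True
  then show ?thesis using assms rmin ratio_le_1[of "[]"] stopped_ratio_le[OF assms(1)] 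
    by (auto intro!: mult_le_one)
next
  case False
  then have u: "u = butlast u @ [last u]" by simp
  then have "butlast u \<in> words" "last u \<in> {1..N}"
    using stopped_words[OF assms(1)] by (metis words_simps(2,3))+
  moreover have "s < ratio (butlast u)" using assms False by (auto simp: stopped_def)
  moreover have "ratio u = ratio (butlast u) * r (last u)"
    using arg_cong[OF u, of ratio] by simp
  ultimately show ?thesis
    using rmin(3)[of "last u"] rmin(1) ratio_pos[of "butlast u"]
    by (simp add: mult.commute[of rmin] mult_mono less_imp_le)
qed

lemma tube_cyl: "u \<in> words \<Longrightarrow> tube (cyl u) \<delta> = ratio u * tube F (\<delta> / ratio u)"
  using tube_similarity_image[OF word_dist ratio_pos F_compact F_nonempty, of u "\<delta> / ratio u"]
    ratio_pos[of u] by (simp add: cyl_def)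

lemma cyl_compact: "u \<in> words \<Longrightarrow> compact (cyl u)"
  unfolding cyl_def by (rule compact_similarity_image[OF word_dist F_compact])

lemma tube_subadditive:
  assumes "finite W" "W \<subseteq> words" "F \<subseteq> (\<Union>u\<in>W. cyl u)"
  shows "tube F \<delta> \<le> (\<Sum>u\<in>W. ratio u * tube F (\<delta> / ratio u))"
proof -
  have "tube F \<delta> \<le> measure lebesgue (\<Union>u\<in>W. right_thickening (cyl u) \<delta>)"
    unfolding tube_def
  proof (intro measure_mono_fmeasurable fmeasurableD right_thickening_lmeasurable F_compact)
    show "right_thickening F \<delta> \<subseteq> (\<Union>u\<in>W. right_thickening (cyl u) \<delta>)"
      using assms(3) unfolding right_thickening_def by blast
    show "(\<Union>u\<in>W. right_thickening (cyl u) \<delta>) \<in> lmeasurable"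
      using assms by (intro fmeasurable.finite_UN) (auto intro: right_thickening_lmeasurable cyl_compact)
  qed
  also have "\<dots> \<le> (\<Sum>u\<in>W. tube (cyl u) \<delta>)"
    unfolding tube_def using assms
    by (intro measure_UNION_le) (auto intro: right_thickening_lmeasurable cyl_compact fmeasurableD)
  also have "\<dots> = (\<Sum>u\<in>W. ratio u * tube F (\<delta> / ratio u))"
    using assms(2) by (intro sum.cong refl tube_cyl) auto
  finally show ?thesis .
qed

lemma card_stopped_le:
  assumes "0 < s" "s \<le> 1"
  shows "real (card (stopped s)) * (rmin * s) powr D \<le> 1"
proof -
  have "(rmin * s) powr D \<le> ratio u powr D" if "u \<in> stopped s" for u
    using stopped_ratio_ge[OF that assms(2)] rmin(1) assms D_pos by (intro powr_mono2) auto
  then show ?thesis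
    using sum_bounded_below[of "stopped s" "(rmin * s) powr D" "\<lambda>u. ratio u powr D"] sum_stopped[OF assms(1)]
    by simp
qed

lemma card_stopped_ge:
  assumes "0 < s"
  shows "1 \<le> real (card (stopped s)) * s powr D"
proof -
  have "ratio u powr D \<le> s powr D" if "u \<in> stopped s" for u
    using stopped_ratio_le[OF that] ratio_pos[OF stopped_words[OF that]] D_pos by (intro powr_mono2) auto
  then show ?thesis
    using sum_bounded_above[of "stopped s" "\<lambda>u. ratio u powr D" "s powr D"] sum_stopped[OF assms(1)]
    by simp
qed

lemma tube_nonneg: "0 \<le> tube F \<delta>"
  by (simp add: tube_def)

text \<open>
  At scale \<open>\<delta>\<close> there are \<open>O(\<delta>\<^bsup>-D\<^esup>)\<close> stopped words, and each of their cylinders contributes \<open>O(\<delta>)\<close>.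
\<close>

lemma tube_upper_bound:
  obtains C where "0 < C" "\<And>\<delta>. 0 < \<delta> \<Longrightarrow> \<delta> \<le> 1 \<Longrightarrow> tube F \<delta> \<le> C * \<delta> powr (1 - D)"
proof
  define C where "C = (tube F (1 / rmin) + 1) * rmin powr (- D)"
  show "0 < C" using rmin tube_nonneg[of "1 / rmin"] by (auto simp: C_def intro!: mult_pos_pos add_nonneg_pos)
  fix \<delta> :: real assume \<delta>: "0 < \<delta>" "\<delta> \<le> 1"
  have "tube F \<delta> \<le> (\<Sum>u\<in>stopped \<delta>. ratio u * tube F (\<delta> / ratio u))"
    using \<delta> by (intro tube_subadditive finite_stopped stopped_cover) (auto simp: stopped_words)
  also have "\<dots> \<le> (\<Sum>u\<in>stopped \<delta>. \<delta> * (tube F (1 / rmin) + 1))"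
  proof (rule sum_mono)
    fix u assume u: "u \<in> stopped \<delta>"
    have "\<delta> / ratio u \<le> 1 / rmin"
      using stopped_ratio_ge[OF u \<delta>(2)] ratio_pos[OF stopped_words[OF u]] rmin(1)
      by (simp add: field_simps)
    then have "tube F (\<delta> / ratio u) \<le> tube F (1 / rmin) + 1"
      using tube_mono[OF F_compact] by (smt (verit))
    then show "ratio u * tube F (\<delta> / ratio u) \<le> \<delta> * (tube F (1 / rmin) + 1)"
      using stopped_ratio_le[OF u] ratio_pos[OF stopped_words[OF u]] \<delta>
      by (intro mult_mono) (auto simp: tube_nonneg)
  qed
  also have "\<dots> = real (card (stopped \<delta>)) * (\<delta> * (tube F (1 / rmin) + 1))" by simp
  also have "\<dots> = (real (card (stopped \<delta>)) * (rmin * \<delta>) powr D) * (C * \<delta> powr (1 - D))"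
  proof -
    have "\<delta> powr D * \<delta> powr (1 - D) = \<delta>" "rmin powr D * rmin powr (- D) = 1"
      using \<delta> rmin(1) by (simp_all flip: powr_add)
    moreover have "(rmin * \<delta>) powr D = rmin powr D * \<delta> powr D"
      using \<delta> rmin(1) by (simp add: powr_mult)
    moreover have "(real (card (stopped \<delta>)) * (rmin powr D * \<delta> powr D)) * (C * \<delta> powr (1 - D))
        = real (card (stopped \<delta>)) * ((\<delta> powr D * \<delta> powr (1 - D)) * (tube F (1 / rmin) + 1))
          * (rmin powr D * rmin powr (- D))"
      unfolding C_def by (simp only: mult_ac)
    ultimately show ?thesis by auto
  qed
  also have "\<dots> \<le> 1 * (C * \<delta> powr (1 - D))"
    using card_stopped_le[OF \<delta>] \<open>0 < C\<close> by (intro mult_right_mono) auto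
  finally show "tube F \<delta> \<le> C * \<delta> powr (1 - D)" by simp
qed

lemma stopped_append:
  assumes "k \<in> words" "v \<in> stopped s" "0 < s" "s \<le> 1"
  shows "k @ v \<in> stopped (ratio k * s)"
  using assms(1)
proof (induction k)
  case Nil
  then show ?case using assms by simp
next
  case (Cons i k)
  then have i: "i \<in> {1..N}" and k: "k \<in> words" by auto
  have "ratio k * s \<le> 1" using ratio_le_1[OF k] ratio_pos[OF k] assms(3,4) by (intro mult_le_one) auto
  then have "r i * (ratio k * s) \<le> r i * 1" using r_bounds(1)[OF i] by (intro mult_left_mono) auto
  then have "ratio (i # k) * s < 1" using r_bounds(2)[OF i] by (simp add: mult.assoc)
  moreover have "ratio (i # k) * s / r i = ratio k * s" using r_bounds(1)[OF i] by simp
  ultimately show ?case using Cons_stopped_iff i Cons.IH[OF k] by simp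
qed

lemma word_stopped: "w \<in> words \<Longrightarrow> w \<in> stopped (ratio w)"
proof -
  assume w: "w \<in> words"
  have "[] \<in> stopped 1" by (simp add: stopped_def)
  from stopped_append[OF w this] show ?thesis by simp
qed

text \<open>
  Successive letters of a \<open>D\<close>-weighted random word can be grouped into blocks taken from the stopped
  words at scale \<open>ratio w\<close>.  Each block equals \<open>w\<close> with probability \<open>ratio w powr D\<close>, independently of
  the others, so \<open>m\<close> blocks avoid \<open>w\<close> with the \<open>m\<close>-th power of the complementary probability.  The
  words in \<open>B\<close> are the ones made of \<open>m\<close> blocks different from \<open>w\<close>, and \<open>k\<close> consists of the blocks before
  the first occurrence of \<open>w\<close>.  The lower bounds hold because a block has ratio at least
  \<open>rmin * ratio w\<close>.
\<close>

lemma avoiding_words: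
  assumes w: "w \<in> words"
  shows "\<exists>B. finite B \<and> B \<subseteq> words \<and> (\<forall>c\<in>B. (rmin * ratio w) ^ m \<le> ratio c)
      \<and> (\<Sum>c\<in>B. ratio c powr D) \<le> (1 - ratio w powr D) ^ m
      \<and> (\<forall>z\<in>F. (\<exists>c\<in>B. z \<in> cyl c) \<or> (\<exists>k\<in>words. (rmin * ratio w) ^ m \<le> ratio k \<and> z \<in> cyl (k @ w)))"
proof (induction m)
  case 0
  show ?case by (rule exI[of _ "{[]}"]) simp
next
  case (Suc m)
  let ?g = "rmin * ratio w"
  have g: "0 < ?g" "?g \<le> 1"
    using rmin ratio_pos[OF w] ratio_le_1[OF w] by (auto intro!: mult_le_one)
  obtain B where B: "finite B" "B \<subseteq> words" "\<And>c. c \<in> B \<Longrightarrow> ?g ^ m \<le> ratio c"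
    "(\<Sum>c\<in>B. ratio c powr D) \<le> (1 - ratio w powr D) ^ m"
    "\<And>z. z \<in> F \<Longrightarrow> (\<exists>c\<in>B. z \<in> cyl c) \<or> (\<exists>k\<in>words. ?g ^ m \<le> ratio k \<and> z \<in> cyl (k @ w))"
    using Suc by blast
  define X where "X = stopped (ratio w) - {w}"
  have w1: "0 < ratio w" "ratio w \<le> 1" using w by (simp_all add: ratio_pos ratio_le_1)
  have X: "finite X" "X \<subseteq> words" using finite_stopped[OF w1(1)] by (auto simp: X_def stopped_words)
  have sumX: "(\<Sum>b\<in>X. ratio b powr D) = 1 - ratio w powr D"
    using sum_stopped[OF w1(1)] sum.remove[OF finite_stopped[OF w1(1)] word_stopped[OF w], of "\<lambda>u. ratio u powr D"]
    by (simp add: X_def)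
  have p: "0 \<le> 1 - ratio w powr D" using sumX by (metis powr_ge_zero sum_nonneg)
  have ratioX: "?g \<le> ratio b" if "b \<in> stopped (ratio w)" for b
    using stopped_ratio_ge[OF that w1(2)] .
  let ?B = "(\<lambda>(c, b). c @ b) ` (B \<times> X)"
  show ?case
  proof (intro exI[of _ ?B] conjI ballI)
    show "finite ?B" using B X by simp
    show "?B \<subseteq> words" using B X by auto
    show "?g ^ Suc m \<le> ratio c" if cB: "c \<in> ?B" for c
    proof -
      obtain c1 b where c: "c = c1 @ b" "c1 \<in> B" "b \<in> X" using cB by auto
      have "?g * ?g ^ m \<le> ratio b * ratio c1"
        using ratioX[of b] B(3)[OF c(2)] c(3) g by (intro mult_mono) (auto simp: X_def)
      then show ?thesis using c(1) by (simp add: mult.commute)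
    qed
    have "(\<Sum>c\<in>?B. ratio c powr D) \<le> (\<Sum>x\<in>B \<times> X. ratio ((\<lambda>(c, b). c @ b) x) powr D)"
      using sum_image_le[of "B \<times> X" "\<lambda>c. ratio c powr D" "\<lambda>(c, b). c @ b"] B(1) X(1)
      by (simp add: o_def)
    also have "\<dots> = (\<Sum>(c, b)\<in>B \<times> X. ratio c powr D * ratio b powr D)"
      using B(2) X(2) by (intro sum.cong refl) (auto simp: powr_mult ratio_pos less_imp_le)
    also have "\<dots> = (\<Sum>c\<in>B. ratio c powr D) * (\<Sum>b\<in>X. ratio b powr D)"
      by (simp add: sum_product sum.cartesian_product)
    also have "\<dots> \<le> (1 - ratio w powr D) ^ m * (1 - ratio w powr D)"
      unfolding sumX using p B(4) by (intro mult_right_mono)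
    finally show "(\<Sum>c\<in>?B. ratio c powr D) \<le> (1 - ratio w powr D) ^ Suc m" by (simp add: mult.commute)
    fix z assume "z \<in> F"
    from B(5)[OF this]
    show "(\<exists>c\<in>?B. z \<in> cyl c) \<or> (\<exists>k\<in>words. ?g ^ Suc m \<le> ratio k \<and> z \<in> cyl (k @ w))"
    proof (elim disjE bexE conjE)
      fix k assume k: "k \<in> words" "?g ^ m \<le> ratio k" "z \<in> cyl (k @ w)"
      have "?g ^ Suc m \<le> ?g ^ m" using g by (intro power_decreasing) auto
      then show ?thesis using k by force
    next
      fix c assume c: "c \<in> B" "z \<in> cyl c"
      then obtain x where x: "x \<in> F" "z = foldr \<phi> c x" by (auto simp: cyl_def)
      then obtain b where b: "b \<in> stopped (ratio w)" "x \<in> cyl b"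
        using stopped_cover[OF w1(1)] by blast
      have z: "z \<in> cyl (c @ b)" using x b by (simp add: cyl_append)
      show ?thesis
      proof (cases "b = w")
        case True
        have "?g ^ Suc m \<le> ?g ^ m" using g by (intro power_decreasing) auto
        then have "?g ^ Suc m \<le> ratio c" using B(3)[OF c(1)] by linarith
        with True z c(1) B(2) show ?thesis by blast
      next
        case False
        then have "c @ b \<in> ?B" using b c(1) by (auto simp: X_def)
        with z show ?thesis by blast
      qed
    qed
  qed
qed

text \<open>
  The points in question are \<open>\<delta>\<close>-separated, and a cylinder has a small tube.
\<close>

lemma card_gap_starts_cyl:
  assumes C: "\<And>\<delta>. 0 < \<delta> \<Longrightarrow> \<delta> \<le> 1 \<Longrightarrow> tube F \<delta> \<le> C * \<delta> powr (1 - D)"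
    and k: "k \<in> words" and \<delta>: "0 < \<delta>" "\<delta> \<le> ratio k"
  shows "real (card (gap_starts F \<delta> \<inter> cyl k)) \<le> C * ratio k powr D * \<delta> powr (- D)"
proof -
  have rk: "0 < ratio k" using k by (rule ratio_pos)
  have "real (card (gap_starts F \<delta> \<inter> cyl k)) * \<delta> \<le> tube (cyl k) \<delta>"
    using finite_gap_starts[OF F_compact \<delta>(1)] \<delta>(1)
    by (intro card_separated_le_tube cyl_compact k) (auto intro: gap_starts_separated)
  also have "\<dots> = ratio k * tube F (\<delta> / ratio k)" by (rule tube_cyl[OF k])
  also have "\<dots> \<le> ratio k * (C * (\<delta> / ratio k) powr (1 - D))"
    using \<delta> rk by (intro mult_left_mono C) auto
  also have "\<dots> = C * (ratio k * ratio k powr (D - 1)) * (\<delta> powr (- D) * \<delta>)"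
  proof -
    have "(\<delta> / ratio k) powr (1 - D) = \<delta> powr (1 - D) * ratio k powr (D - 1)"
      using \<delta> rk by (simp add: powr_divide powr_diff field_simps)
    moreover have "\<delta> powr (1 - D) = \<delta> powr (- D) * \<delta>"
      using \<delta> by (simp add: powr_diff powr_minus field_simps)
    ultimately show ?thesis by (simp add: mult_ac)
  qed
  also have "ratio k * ratio k powr (D - 1) = ratio k powr D" using rk by (simp add: powr_mult_base)
  finally have "real (card (gap_starts F \<delta> \<inter> cyl k)) * \<delta> \<le> (C * ratio k powr D * \<delta> powr (- D)) * \<delta>"
    by (simp add: mult_ac)
  then show ?thesis using \<delta>(1) by simp
qed

text \<open>
  The cylinder is a subset of \<open>F\<close>, so a point of \<open>F\<close> between the preimages of the two ends would be
  mapped into the gap.  The map may reverse orientation, so the preimage of the left end can be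
  either end of the gap that is found.
\<close>

lemma gap_pullback:
  assumes k: "k \<in> words" and y: "y \<in> cyl k" "y + l \<in> cyl k" and l: "0 < l" and gap: "F \<inter> {y<..<y + l} = {}"
  shows "gaps_of_length F (l / ratio k) \<noteq> {}"
proof -
  have rk: "0 < ratio k" using k by (rule ratio_pos)
  obtain a b where ab: "a \<in> F" "b \<in> F" "y = foldr \<phi> k a" "y + l = foldr \<phi> k b"
    using y by (auto simp: cyl_def)
  have lab: "ratio k * \<bar>a - b\<bar> = l" using word_dist[OF k, of a b] ab l by simp
  have none: "F \<inter> {min a b<..<max a b} = {}"
  proof (rule ccontr)
    assume "F \<inter> {min a b<..<max a b} \<noteq> {}"
    then obtain z where z: "z \<in> F" "min a b < z" "z < max a b" by auto
    let ?z = "foldr \<phi> k z"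
    have zF: "?z \<in> F" using cyl_subset[OF k] z(1) by (auto simp: cyl_def)
    have za: "\<bar>z - a\<bar> + \<bar>z - b\<bar> = \<bar>a - b\<bar>" "0 < \<bar>z - a\<bar>" "0 < \<bar>z - b\<bar>"
      using z by (auto simp: min_def max_def split: if_splits)
    have d: "\<bar>?z - y\<bar> = ratio k * \<bar>z - a\<bar>" "\<bar>?z - (y + l)\<bar> = ratio k * \<bar>z - b\<bar>"
      using word_dist[OF k, of z a] word_dist[OF k, of z b] ab(3,4) by metis+
    have "\<bar>?z - y\<bar> + \<bar>?z - (y + l)\<bar> = ratio k * (\<bar>z - a\<bar> + \<bar>z - b\<bar>)"
      unfolding d by (simp add: distrib_left)
    then have "\<bar>?z - y\<bar> + \<bar>?z - (y + l)\<bar> = l" unfolding za(1) lab .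
    moreover have "0 < \<bar>?z - y\<bar>" "0 < \<bar>?z - (y + l)\<bar>"
      unfolding d using rk za by (simp_all add: mult_pos_pos)
    ultimately have "?z \<in> F \<inter> {y<..<y + l}" using zF by (auto simp: abs_if split: if_splits)
    with gap show False by blast
  qed
  have "l / ratio k = \<bar>a - b\<bar>" using lab rk by (simp add: field_simps)
  then have "max a b = min a b + l / ratio k" by (simp add: min_def max_def)
  then have "min a b \<in> gaps_of_length F (l / ratio k)"
    unfolding gaps_of_length_def using none ab(1,2) by (auto simp: min_def max_def split: if_splits)
  then show ?thesis by blast
qed

lemma log_periodic_ratio:
  assumes "\<And>i. i \<in> {1..N} \<Longrightarrow> \<exists>j::nat. r i = \<rho> ^ j" "u \<in> words"
  shows "\<exists>j::nat. ratio u = \<rho> ^ j"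
  using assms(2)
proof (induction u)
  case Nil
  then show ?case by (intro exI[of _ 0]) simp
next
  case (Cons i u)
  then obtain j1 j2 where "r i = \<rho> ^ j1" "ratio u = \<rho> ^ j2" using assms(1)[of i] by auto
  then have "ratio (i # u) = \<rho> ^ (j1 + j2)" by (simp add: power_add)
  then show ?case by blast
qed

text \<open>
  The base is \<open>exp (- h)\<close>, where \<open>h > 0\<close> generates the group of the logarithms of the ratios.
\<close>

lemma lattice_common_ratio:
  assumes "lattice_ratios N r"
  obtains \<rho> where "0 < \<rho>" "\<rho> < 1" "\<And>i. i \<in> {1..N} \<Longrightarrow> \<exists>j::nat. r i = \<rho> ^ j"
proof -
  have neg: "ln (r i) < 0" if "i \<in> {1..N}" for i using r_bounds[OF that] by simp
  have "ln (r 1) \<in> (\<lambda>i. ln (r i)) ` {1..N}" "ln (r 1) \<noteq> 0" using N neg[of 1] by auto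
  from discrete_group_closure_cyclic[OF assms[unfolded lattice_ratios_def] this]
  obtain h where h: "0 < h" "\<And>s. s \<in> (\<lambda>i. ln (r i)) ` {1..N} \<Longrightarrow> \<exists>k::int. s = of_int k * h"
    by blast
  show thesis
  proof
    show "0 < exp (- h)" "exp (- h) < 1" using h(1) by auto
    fix i assume i: "i \<in> {1..N}"
    then obtain k :: int where k: "ln (r i) = of_int k * h" using h(2) by blast
    have "k < 0" using neg[OF i] h(1) unfolding k by (simp add: mult_less_0_iff)
    then have "real (nat (- k)) * (- h) = of_int k * h" by simp
    then have "exp (ln (r i)) = exp (- h) ^ nat (- k)"
      unfolding k by (metis exp_of_nat_mult)
    then show "\<exists>j::nat. r i = exp (- h) ^ j" using r_bounds(1)[OF i] by auto
  qed
qed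

end

section \<open>Packing under the open set condition\<close>

locale osc_system = similarity_system +
  assumes osc: "open_set_condition N \<phi>"
begin

text \<open>
  Distinct words in a stopping set branch at some letter, where the open set condition separates
  the images of the open set.  A compact interval inside this open set inherits the disjointness.
\<close>

lemma disjoint_interval_images:
  obtains a b where "a < b"
    "\<And>s u v. \<lbrakk>0 < s; u \<in> stopped s; v \<in> stopped s; u \<noteq> v\<rbrakk>
      \<Longrightarrow> foldr \<phi> u ` {a..b} \<inter> foldr \<phi> v ` {a..b} = {}"
proof -
  obtain U where "open U" "U \<noteq> {}" and stable: "\<forall>i\<in>{1..N}. \<phi> i ` U \<subseteq> U"
    and apart: "\<forall>i\<in>{1..N}. \<forall>j\<in>{1..N}. i \<noteq> j \<longrightarrow> \<phi> i ` U \<inter> \<phi> j ` U = {}"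
    using osc unfolding open_set_condition_def by (elim exE conjE)
  have inside: "foldr \<phi> u x \<in> U" if "u \<in> words" "x \<in> U" for u x
    using that(1)
  proof (induction u)
    case Nil
    then show ?case using that(2) by simp
  next
    case (Cons i u)
    then have "\<phi> i (foldr \<phi> u x) \<in> \<phi> i ` U" by simp
    moreover have "\<phi> i ` U \<subseteq> U" using stable Cons.prems by simp
    ultimately show ?case by auto
  qed
  have disj: "\<forall>u\<in>stopped s. \<forall>v\<in>stopped s. u \<noteq> v \<longrightarrow> foldr \<phi> u ` U \<inter> foldr \<phi> v ` U = {}"
    if "0 < s" for s
    using that
  proof (induction s rule: scale_induct)
    case (large s)
    then show ?case by (simp add: stopped_large)
  next
    case (small s)
    show ?case
    proof (intro ballI impI)
      fix u v assume uv: "u \<in> stopped s" "v \<in> stopped s" "u \<noteq> v"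
      obtain i u' where u: "u = i # u'" "i \<in> {1..N}" "u' \<in> stopped (s / r i)"
        using uv(1) unfolding stopped_small[OF small(2)] by blast
      obtain j v' where v: "v = j # v'" "j \<in> {1..N}" "v' \<in> stopped (s / r j)"
        using uv(2) unfolding stopped_small[OF small(2)] by blast
      have *: "foldr \<phi> u ` U = \<phi> i ` foldr \<phi> u' ` U" "foldr \<phi> v ` U = \<phi> j ` foldr \<phi> v' ` U"
        by (simp_all add: u v image_image)
      show "foldr \<phi> u ` U \<inter> foldr \<phi> v ` U = {}"
      proof (cases "i = j")
        case True
        have "inj (\<phi> i)"
        proof (rule injI)
          fix x y assume "\<phi> i x = \<phi> i y"
          then show "x = y" using map_dist[OF u(2), of x y] r_bounds[OF u(2)] by simp
        qed
        moreover have "foldr \<phi> u' ` U \<inter> foldr \<phi> v' ` U = {}"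
          using small(3)[OF u(2)] u v uv(3) True by blast
        ultimately show ?thesis unfolding * True[symmetric] by (metis image_Int image_empty)
      next
        case False
        have "foldr \<phi> u' ` U \<subseteq> U" "foldr \<phi> v' ` U \<subseteq> U"
          using inside stopped_words u v by blast+
        then show ?thesis unfolding * using apart u(2) v(2) False by blast
      qed
    qed
  qed
  obtain x e where "x \<in> U" "0 < e" "cball x e \<subseteq> U"
    using \<open>open U\<close> \<open>U \<noteq> {}\<close> by (meson all_not_in_conv open_contains_cball)
  then have ab: "{x - e..x + e} \<subseteq> U" "x - e < x + e" by (auto simp: cball_eq_atLeastAtMost)
  have "foldr \<phi> u ` {x - e..x + e} \<inter> foldr \<phi> v ` {x - e..x + e} = {}"
    if "0 < s" "u \<in> stopped s" "v \<in> stopped s" "u \<noteq> v" for s u v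
  proof -
    have "foldr \<phi> u ` U \<inter> foldr \<phi> v ` U = {}" using disj that by simp
    then show ?thesis
      using image_mono[OF ab(1), of "foldr \<phi> u"] image_mono[OF ab(1), of "foldr \<phi> v"]
      by (meson disjoint_iff subsetD)
  qed
  then show thesis using that[of "x - e" "x + e"] ab(2) by blast
qed

text \<open>
  The images of the reference interval under stopped words are disjoint, have length comparable to
  the scale, and stay within a multiple of the scale from the images of a point \<open>x0\<close> of \<open>F\<close>.  Hence
  only boundedly many stopped cylinders meet a ball of the given scale, and \<open>F\<close> has a large tube.
\<close>

lemma reference_packing:
  obtains x0 R c where "x0 \<in> F" "1 \<le> R" "0 < c"
    "\<And>s W T. \<lbrakk>0 < s; s \<le> 1; W \<subseteq> stopped s; compact T;
        \<And>u z. u \<in> W \<Longrightarrow> \<bar>z - foldr \<phi> u x0\<bar> \<le> R * s \<Longrightarrow> z \<in> T\<rbrakk>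
      \<Longrightarrow> real (card W) * (c * s) \<le> measure lebesgue T"
proof -
  obtain a b where ab: "a < b"
    "\<And>s u v. \<lbrakk>0 < s; u \<in> stopped s; v \<in> stopped s; u \<noteq> v\<rbrakk>
      \<Longrightarrow> foldr \<phi> u ` {a..b} \<inter> foldr \<phi> v ` {a..b} = {}"
    using disjoint_interval_images by metis
  obtain x0 where x0: "x0 \<in> F" using F_nonempty by blast
  define R where "R = 1 + \<bar>a - x0\<bar> + \<bar>b - x0\<bar>"
  have R: "\<bar>x - x0\<bar> \<le> R" if "x \<in> {a..b}" for x using that by (auto simp: R_def)
  show thesis
  proof
    show "x0 \<in> F" by fact
    show "1 \<le> R" by (simp add: R_def)
    show "0 < rmin * (b - a)" using rmin ab by simp
    fix s and W :: "nat list set" and T :: "real set"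
    assume s: "0 < s" "s \<le> 1" and W: "W \<subseteq> stopped s" and T: "compact T"
      "\<And>u z. u \<in> W \<Longrightarrow> \<bar>z - foldr \<phi> u x0\<bar> \<le> R * s \<Longrightarrow> z \<in> T"
    show "real (card W) * (rmin * (b - a) * s) \<le> measure lebesgue T"
    proof (rule disjoint_packing[where J = "\<lambda>u. foldr \<phi> u ` {a..b}"])
      show "finite W" using W finite_stopped[OF s(1)] by (rule finite_subset)
      show "T \<in> lmeasurable" using T(1) by (rule lmeasurable_compact)
      show "disjoint_family_on (\<lambda>u. foldr \<phi> u ` {a..b}) W"
        unfolding disjoint_family_on_def using ab(2)[OF s(1)] W by blast
      fix u assume u: "u \<in> W"
      then have us: "u \<in> stopped s" and uw: "u \<in> words" using W stopped_words by auto
      show "foldr \<phi> u ` {a..b} \<in> lmeasurable"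
        by (intro lmeasurable_compact compact_similarity_image[OF word_dist[OF uw]]) simp
      show "rmin * (b - a) * s \<le> measure lebesgue (foldr \<phi> u ` {a..b})"
        unfolding measure_similarity_image[OF word_dist[OF uw]]
        using stopped_ratio_ge[OF us s(2)] ab(1) mult_right_mono[of "rmin * s" "ratio u" "b - a"]
        by (simp add: mult_ac)
      show "foldr \<phi> u ` {a..b} \<subseteq> T"
      proof
        fix z assume "z \<in> foldr \<phi> u ` {a..b}"
        then obtain x where x: "x \<in> {a..b}" "z = foldr \<phi> u x" by blast
        have "\<bar>z - foldr \<phi> u x0\<bar> = ratio u * \<bar>x - x0\<bar>" using word_dist[OF uw] x by simp
        also have "\<dots> \<le> s * R"
          using stopped_ratio_le[OF us] R[OF x(1)] ratio_pos[OF uw] s by (intro mult_mono) auto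
        finally show "z \<in> T" using T(2)[OF u] by (simp add: mult.commute)
      qed
    qed
  qed
qed

text \<open>
  At scale \<open>s\<close> there are at least \<open>s\<^bsup>-D\<^esup>\<close> stopped words, and their reference intervals fit disjointly
  into a parallel set of radius proportional to \<open>s\<close>.
\<close>

lemma tube_lower_bound:
  obtains c where "0 < c" "\<And>\<delta>. 0 < \<delta> \<Longrightarrow> \<delta> \<le> 1 \<Longrightarrow> c * \<delta> powr (1 - D) \<le> tube F \<delta>"
proof -
  obtain x0 R c where ref: "x0 \<in> F" "1 \<le> R" "0 < c"
    "\<And>s W T. \<lbrakk>0 < s; s \<le> 1; W \<subseteq> stopped s; compact T;
        \<And>u z. u \<in> W \<Longrightarrow> \<bar>z - foldr \<phi> u x0\<bar> \<le> R * s \<Longrightarrow> z \<in> T\<rbrakk>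
      \<Longrightarrow> real (card W) * (c * s) \<le> measure lebesgue T"
    using reference_packing by metis
  show thesis
  proof
    show "0 < c * (2 * R) powr (D - 1)" using ref by simp
    fix \<delta> :: real assume \<delta>: "0 < \<delta>" "\<delta> \<le> 1"
    define s where "s = \<delta> / (2 * R)"
    have s: "0 < s" "s \<le> 1" "2 * (R * s) = \<delta>" using \<delta> ref(2) by (auto simp: s_def field_simps)
    have "real (card (stopped s)) * (c * s) \<le> measure lebesgue (parallel_set F (R * s))"
    proof (rule ref(4)[OF s(1,2)])
      show "compact (parallel_set F (R * s))" by (rule compact_parallel_set[OF F_compact F_nonempty])
      fix u z assume "u \<in> stopped s" and z: "\<bar>z - foldr \<phi> u x0\<bar> \<le> R * s"
      then have "foldr \<phi> u x0 \<in> F" using cyl_subset[OF stopped_words, of u s] ref(1) by (auto simp: cyl_def)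
      with z show "z \<in> parallel_set F (R * s)"
        unfolding parallel_set_iff[OF F_compact F_nonempty] by blast
    qed simp
    also have "\<dots> = tube F \<delta>"
      using measure_parallel_set[OF F_compact F_nonempty, of "R * s"] s(3)
        compact_parallel_set[OF F_compact F_nonempty, of "R * s"]
      by (simp add: measure_completion borel_compact)
    finally have upper: "real (card (stopped s)) * (c * s) \<le> tube F \<delta>" .
    have "c * (2 * R) powr (D - 1) * \<delta> powr (1 - D) = c * s powr (1 - D)"
    proof -
      have "s powr (1 - D) = \<delta> powr (1 - D) * (2 * R) powr (D - 1)"
        unfolding s_def using \<delta> ref(2) by (simp add: powr_divide powr_diff field_simps)
      then show ?thesis by simp
    qed
    also have "\<dots> \<le> c * s powr (1 - D) * (real (card (stopped s)) * s powr D)"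
      using card_stopped_ge[OF s(1)] ref(3) mult_left_mono[of 1 _ "c * s powr (1 - D)"] by simp
    also have "\<dots> = real (card (stopped s)) * (c * (s powr (1 - D) * s powr D))" by (simp add: mult_ac)
    also have "s powr (1 - D) * s powr D = s" using s(1) by (simp flip: powr_add)
    finally show "c * (2 * R) powr (D - 1) * \<delta> powr (1 - D) \<le> tube F \<delta>" using upper by linarith
  qed
qed

definition neighbours :: "nat list \<Rightarrow> nat list set" where
  "neighbours u = {v \<in> stopped (ratio u). \<exists>x\<in>cyl u. \<exists>y\<in>cyl v. \<bar>x - y\<bar> \<le> ratio u}"

lemma neighbours_bounded:
  obtains K where "\<And>u. u \<in> words \<Longrightarrow> card (neighbours u) \<le> K"
proof -
  obtain x0 R c where ref: "x0 \<in> F" "1 \<le> R" "0 < c"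
    "\<And>s W T. \<lbrakk>0 < s; s \<le> 1; W \<subseteq> stopped s; compact T;
        \<And>u z. u \<in> W \<Longrightarrow> \<bar>z - foldr \<phi> u x0\<bar> \<le> R * s \<Longrightarrow> z \<in> T\<rbrakk>
      \<Longrightarrow> real (card W) * (c * s) \<le> measure lebesgue T"
    using reference_packing by metis
  define E where "E = diameter F"
  have E: "\<bar>x - y\<bar> \<le> E" if "x \<in> F" "y \<in> F" for x y
    using diameter_bounded_bound[OF compact_imp_bounded[OF F_compact] that]
    by (simp add: E_def dist_real_def)
  have E0: "0 \<le> E" using E[OF ref(1) ref(1)] by simp
  define H where "H = R + 2 * E + 1"
  have "card (neighbours u) \<le> nat \<lfloor>2 * H / c\<rfloor>" if u: "u \<in> words" for u
  proof -
    let ?s = "ratio u" and ?o = "foldr \<phi> u x0"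
    have s: "0 < ?s" "?s \<le> 1" using u by (simp_all add: ratio_pos ratio_le_1)
    have "real (card (neighbours u)) * (c * ?s) \<le> measure lebesgue {?o - H * ?s..?o + H * ?s}"
    proof (rule ref(4)[OF s])
      fix v z assume v: "v \<in> neighbours u" and z: "\<bar>z - foldr \<phi> v x0\<bar> \<le> R * ?s"
      have vs: "v \<in> stopped ?s" using v by (simp add: neighbours_def)
      obtain x y where xy: "x \<in> F" "y \<in> F" "\<bar>foldr \<phi> u x - foldr \<phi> v y\<bar> \<le> ?s"
        using v by (auto simp: neighbours_def cyl_def)
      have "\<bar>foldr \<phi> v x0 - foldr \<phi> v y\<bar> = ratio v * \<bar>x0 - y\<bar>"
        by (rule word_dist[OF stopped_words[OF vs]])
      also have "\<dots> \<le> ?s * E"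
        using stopped_ratio_le[OF vs] E[OF ref(1) xy(2)] s E0 by (intro mult_mono) auto
      finally have 1: "\<bar>foldr \<phi> v x0 - foldr \<phi> v y\<bar> \<le> ?s * E" .
      have 2: "\<bar>foldr \<phi> u x - ?o\<bar> \<le> ?s * E"
        unfolding word_dist[OF u] using E[OF xy(1) ref(1)] s by (intro mult_left_mono) auto
      have "\<bar>z - ?o\<bar> \<le> R * ?s + ?s * E + ?s + ?s * E"
        using z 1 2 xy(3) by linarith
      also have "\<dots> = H * ?s" by (simp add: H_def algebra_simps)
      finally show "z \<in> {?o - H * ?s..?o + H * ?s}" by (auto simp: abs_le_iff)
    qed (auto simp: neighbours_def)
    also have "\<dots> = 2 * H * ?s" using ref(2) E0 s by (simp add: H_def)
    finally have "real (card (neighbours u)) \<le> 2 * H / c" using s ref(3) by (simp add: field_simps)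
    then show ?thesis by (simp add: le_nat_floor)
  qed
  with that show thesis by blast
qed

text \<open>
  Schief's argument for the strong open set condition.  Choose \<open>w\<close> with as many neighbours as
  possible.  Prefixing \<open>k\<close> maps neighbours of \<open>w\<close> to neighbours of \<open>kw\<close>, so by maximality \<open>kw\<close> has no
  others.  All cylinders near that of \<open>kw\<close> therefore lie in the cylinder of \<open>k\<close>.
\<close>

lemma isolating_word:
  obtains w where "w \<in> words"
    "\<And>k x y. \<lbrakk>k \<in> words; x \<in> cyl (k @ w); y \<in> F; \<bar>x - y\<bar> \<le> ratio (k @ w)\<rbrakk> \<Longrightarrow> y \<in> cyl k"
proof -
  obtain K where K: "\<And>u. u \<in> words \<Longrightarrow> card (neighbours u) \<le> K" using neighbours_bounded by blast
  obtain w where w: "w \<in> words" "\<And>u. u \<in> words \<Longrightarrow> card (neighbours u) \<le> card (neighbours w)"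
    using ex_has_greatest_nat[of "\<lambda>u. u \<in> words" "[]" "\<lambda>u. card (neighbours u)" "Suc K"] K
    by (auto simp: less_Suc_eq_le)
  have "y \<in> cyl k" if k: "k \<in> words" and x: "x \<in> cyl (k @ w)" and y: "y \<in> F" "\<bar>x - y\<bar> \<le> ratio (k @ w)" for k x y
  proof -
    have kw: "k @ w \<in> words" using k w(1) by simp
    have pos: "0 < ratio (k @ w)" using kw by (rule ratio_pos)
    have sub: "(@) k ` neighbours w \<subseteq> neighbours (k @ w)"
    proof
      fix v assume "v \<in> (@) k ` neighbours w"
      then obtain v' where v: "v = k @ v'" "v' \<in> stopped (ratio w)" and
        ex: "\<exists>x\<in>cyl w. \<exists>y\<in>cyl v'. \<bar>x - y\<bar> \<le> ratio w" by (auto simp: neighbours_def)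
      obtain x y where xy: "x \<in> cyl w" "y \<in> cyl v'" "\<bar>x - y\<bar> \<le> ratio w" using ex by blast
      have "\<bar>foldr \<phi> k x - foldr \<phi> k y\<bar> \<le> ratio (k @ w)"
        unfolding word_dist[OF k] using xy(3) ratio_pos[OF k] by simp
      moreover have "v \<in> stopped (ratio (k @ w))"
        using stopped_append[OF k v(2)] ratio_pos[OF w(1)] ratio_le_1[OF w(1)] v(1) by simp
      moreover have "foldr \<phi> k x \<in> cyl (k @ w)" "foldr \<phi> k y \<in> cyl v"
        using xy v(1) by (auto simp: cyl_append)
      ultimately show "v \<in> neighbours (k @ w)" unfolding neighbours_def by blast
    qed
    have fin: "finite (neighbours (k @ w))"
      using finite_stopped[OF pos] by (simp add: neighbours_def)
    have "card ((@) k ` neighbours w) = card (neighbours w)" by (intro card_image) (simp add: inj_on_def)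
    then have eq: "(@) k ` neighbours w = neighbours (k @ w)"
      using card_seteq[OF fin sub] w(2)[OF kw] by simp
    obtain v where v: "v \<in> stopped (ratio (k @ w))" "y \<in> cyl v"
      using stopped_cover[OF pos] y(1) by blast
    then have "v \<in> neighbours (k @ w)" using x y(2) unfolding neighbours_def by blast
    then obtain v' where v': "v = k @ v'" "v' \<in> neighbours w" using eq by blast
    have "v' \<in> words" using v'(2) stopped_words by (auto simp: neighbours_def)
    then show ?thesis using cyl_append_subset[OF k] v(2) v'(1) by blast
  qed
  with w(1) that show thesis by blast
qed

section \<open>Minkowski dimension and content of the self-similar set\<close>

lemma minkowski_dimension: "minkowski_dim_exists F" "minkowski_dim F = D"
proof -
  obtain C where C: "0 < C" "\<And>\<delta>. 0 < \<delta> \<Longrightarrow> \<delta> \<le> 1 \<Longrightarrow> tube F \<delta> \<le> C * \<delta> powr (1 - D)"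
    using tube_upper_bound by blast
  obtain c where c: "0 < c" "\<And>\<delta>. 0 < \<delta> \<Longrightarrow> \<delta> \<le> 1 \<Longrightarrow> c * \<delta> powr (1 - D) \<le> tube F \<delta>"
    using tube_lower_bound by blast
  have lim: "((\<lambda>\<epsilon>. ln (a * (2 * \<epsilon>) powr (1 - D)) / ln \<epsilon>) \<longlongrightarrow> 1 - D) (at_right 0)" if "0 < a" for a :: real
  proof -
    have "((\<lambda>\<epsilon>. (ln a + (1 - D) * ln (2 * \<epsilon>)) / ln \<epsilon>) \<longlongrightarrow> 1 - D) (at_right 0)"
      by real_asymp
    moreover have "\<forall>\<^sub>F \<epsilon> in at_right 0. (ln a + (1 - D) * ln (2 * \<epsilon>)) / ln \<epsilon>
        = ln (a * (2 * \<epsilon>) powr (1 - D)) / ln \<epsilon>"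
      using eventually_at_right_less[of 0]
      by eventually_elim (use that in \<open>simp add: ln_mult ln_powr\<close>)
    ultimately show ?thesis by (rule Lim_transform_eventually)
  qed
  have small: "\<forall>\<^sub>F \<epsilon>::real in at_right 0. 0 < \<epsilon> \<and> \<epsilon> < 1 / 2"
    by (rule eventually_at_rightI[of 0 "1 / 2"]) auto
  have "((\<lambda>\<epsilon>. ln (measure lborel (parallel_set F \<epsilon>)) / ln \<epsilon>) \<longlongrightarrow> 1 - D) (at_right 0)"
  proof (rule tendsto_sandwich[OF _ _ lim[OF C(1)] lim[OF c(1)]])
    show "\<forall>\<^sub>F \<epsilon> in at_right 0. ln (C * (2 * \<epsilon>) powr (1 - D)) / ln \<epsilon>
        \<le> ln (measure lborel (parallel_set F \<epsilon>)) / ln \<epsilon>"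
      using small
    proof eventually_elim
      case (elim \<epsilon>)
      have "0 < c * (2 * \<epsilon>) powr (1 - D)" using c(1) elim by simp
      then have "0 < tube F (2 * \<epsilon>)" using c(2)[of "2 * \<epsilon>"] elim by linarith
      then have "ln (tube F (2 * \<epsilon>)) \<le> ln (C * (2 * \<epsilon>) powr (1 - D))"
        using C elim by (intro ln_mono) auto
      then show ?case
        unfolding measure_parallel_set[OF F_compact F_nonempty]
        using elim by (intro divide_right_mono_neg) auto
    qed
    show "\<forall>\<^sub>F \<epsilon> in at_right 0. ln (measure lborel (parallel_set F \<epsilon>)) / ln \<epsilon>
        \<le> ln (c * (2 * \<epsilon>) powr (1 - D)) / ln \<epsilon>"
      using small
    proof eventually_elim
      case (elim \<epsilon>)
      have "0 < c * (2 * \<epsilon>) powr (1 - D)" using c(1) elim by simp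
      moreover from this have "0 < tube F (2 * \<epsilon>)" using c(2)[of "2 * \<epsilon>"] elim by linarith
      ultimately have "ln (c * (2 * \<epsilon>) powr (1 - D)) \<le> ln (tube F (2 * \<epsilon>))"
        using c(2)[of "2 * \<epsilon>"] elim by (intro ln_mono) auto
      then show ?case
        unfolding measure_parallel_set[OF F_compact F_nonempty]
        using elim by (intro divide_right_mono_neg) auto
    qed
  qed
  then show "minkowski_dim_exists F" "minkowski_dim F = D"
    unfolding minkowski_dim_exists_def minkowski_dim_def
    by (blast, simp add: tendsto_Lim)
qed

text \<open>
  The tube of thickness \<open>\<delta>\<close> has the measure of the parallel set of radius \<open>\<delta> / 2\<close>, which changes the
  limit only by the factor \<open>2\<^bsup>D-1\<^esup>\<close>.
\<close>

lemma minkowski_measurable_iff: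
  "minkowski_measurable F \<longleftrightarrow> (\<exists>L>0. ((\<lambda>\<delta>. tube F \<delta> * \<delta> powr (D - 1)) \<longlongrightarrow> L) (at_right 0))"
proof
  assume "minkowski_measurable F"
  then obtain M where M: "has_minkowski_content F M" "0 < M" "M < \<infinity>"
    unfolding minkowski_measurable_def by blast
  then obtain x where x: "M = ereal x" "0 < x" by (cases M) auto
  have "((\<lambda>\<epsilon>. \<epsilon> powr (D - 1) * tube F (2 * \<epsilon>)) \<longlongrightarrow> x) (at_right 0)"
    using M(1) unfolding has_minkowski_content_def x(1) minkowski_dimension(2)
      measure_parallel_set[OF F_compact F_nonempty] by simp
  from filterlim_compose[OF this filterlim_times_at_right_0[of "1 / 2"]]
  have "((\<lambda>\<delta>. (1 / 2 * \<delta>) powr (D - 1) * tube F (2 * (1 / 2 * \<delta>)) * 2 powr (D - 1)) \<longlongrightarrow> x * 2 powr (D - 1)) (at_right 0)"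
    by (intro tendsto_mult_right) simp
  moreover have "\<forall>\<^sub>F \<delta> in at_right 0. (1 / 2 * \<delta>) powr (D - 1) * tube F (2 * (1 / 2 * \<delta>)) * 2 powr (D - 1)
      = tube F \<delta> * \<delta> powr (D - 1)"
    using eventually_at_right_less[of 0]
  proof eventually_elim
    case (elim \<delta>)
    have "(1 / 2 * \<delta>) powr (D - 1) * 2 powr (D - 1) = \<delta> powr (D - 1)"
      using elim powr_mult[of "1 / 2 * \<delta>" 2 "D - 1"] by simp
    then show ?case by (simp add: mult_ac)
  qed
  ultimately have "((\<lambda>\<delta>. tube F \<delta> * \<delta> powr (D - 1)) \<longlongrightarrow> x * 2 powr (D - 1)) (at_right 0)"
    by (rule Lim_transform_eventually)
  with x(2) show "\<exists>L>0. ((\<lambda>\<delta>. tube F \<delta> * \<delta> powr (D - 1)) \<longlongrightarrow> L) (at_right 0)"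
    by (intro exI[of _ "x * 2 powr (D - 1)"]) simp
next
  assume "\<exists>L>0. ((\<lambda>\<delta>. tube F \<delta> * \<delta> powr (D - 1)) \<longlongrightarrow> L) (at_right 0)"
  then obtain L where L: "0 < L" "((\<lambda>\<delta>. tube F \<delta> * \<delta> powr (D - 1)) \<longlongrightarrow> L) (at_right 0)" by blast
  have "((\<lambda>\<epsilon>. tube F (2 * \<epsilon>) * (2 * \<epsilon>) powr (D - 1) * 2 powr (1 - D)) \<longlongrightarrow> L * 2 powr (1 - D)) (at_right 0)"
    by (intro tendsto_mult_right filterlim_compose[OF L(2) filterlim_times_at_right_0]) simp
  moreover have "\<forall>\<^sub>F \<epsilon> in at_right 0. tube F (2 * \<epsilon>) * (2 * \<epsilon>) powr (D - 1) * 2 powr (1 - D)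
      = \<epsilon> powr (D - 1) * tube F (2 * \<epsilon>)"
    using eventually_at_right_less[of 0]
  proof eventually_elim
    case (elim \<epsilon>)
    have "(2 * \<epsilon>) powr (D - 1) * 2 powr (1 - D) = \<epsilon> powr (D - 1)"
      using elim by (simp add: powr_mult powr_diff)
    then show ?case by (simp add: mult_ac)
  qed
  ultimately have "((\<lambda>\<epsilon>. \<epsilon> powr (D - 1) * tube F (2 * \<epsilon>)) \<longlongrightarrow> L * 2 powr (1 - D)) (at_right 0)"
    by (rule Lim_transform_eventually)
  then have "has_minkowski_content F (ereal (L * 2 powr (1 - D)))"
    unfolding has_minkowski_content_def minkowski_dimension(2)
      measure_parallel_set[OF F_compact F_nonempty] using minkowski_dimension(1) by simp
  then show "minkowski_measurable F"
    unfolding minkowski_measurable_def using L(1) by (intro exI[of _ "ereal (L * 2 powr (1 - D))"]) simp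
qed

section \<open>Nonlattice systems\<close>

text \<open>
  On the logarithmic scale \<open>\<delta> = e\<^bsup>-t\<^esup>\<close> the normalised tube measure is bounded, uniformly continuous by
  \<open>tube_scale_le\<close>, and satisfies the renewal inequality with weights \<open>r\<^sub>i\<^sup>D\<close> and steps \<open>- ln r\<^sub>i\<close>.
\<close>

lemma nonlattice_limit:
  assumes nonlattice: "\<not> lattice_ratios N r"
  shows "\<exists>L. ((\<lambda>\<delta>. tube F \<delta> * \<delta> powr (D - 1)) \<longlongrightarrow> L) (at_right 0)"
proof -
  obtain C where C: "0 < C" "\<And>\<delta>. 0 < \<delta> \<Longrightarrow> \<delta> \<le> 1 \<Longrightarrow> tube F \<delta> \<le> C * \<delta> powr (1 - D)"
    using tube_upper_bound by blast
  define f where "f t = tube F (exp (- t)) * exp (t * (1 - D))" for t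
  define \<tau> where "\<tau> i = - ln (r i)" for i
  have f_bound: "0 \<le> f t" "f t \<le> C" if "0 \<le> t" for t
  proof -
    show "0 \<le> f t" by (simp add: f_def tube_nonneg)
    have "tube F (exp (- t)) \<le> C * exp (- t) powr (1 - D)" using C(2) that by simp
    then have "f t \<le> C * exp (- t) powr (1 - D) * exp (t * (1 - D))"
      unfolding f_def by (intro mult_right_mono) auto
    also have "exp (- t) powr (1 - D) * exp (t * (1 - D)) = 1"
      by (simp add: powr_def algebra_simps flip: exp_add)
    then have "C * exp (- t) powr (1 - D) * exp (t * (1 - D)) = C" by (simp add: mult.assoc)
    finally show "f t \<le> C" .
  qed
  \<comment> \<open>Both the exponential factor and the tube measure change by at most exponential factors in
    \<open>u - t\<close>; the exponent \<open>1 + D\<close> dominates the two exponents \<open>1 - D\<close> and \<open>D\<close> that occur.\<close>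
  have modulus: "\<bar>f t - f u\<bar> \<le> C * (exp ((1 + D) * (u - t)) - 1)" if tu: "0 \<le> t" "t \<le> u" for t u
  proof -
    let ?s = "u - t"
    have "tube F (exp ?s * exp (- u)) \<le> exp ?s * tube F (exp (- u))"
      using tu by (intro tube_scale_le F_compact) auto
    then have lo: "tube F (exp (- t)) \<le> exp ?s * tube F (exp (- u))" by (simp flip: exp_add)
    have hi: "tube F (exp (- u)) \<le> tube F (exp (- t))" using tu by (intro tube_mono F_compact) simp
    have eu: "exp (u * (1 - D)) = exp (t * (1 - D)) * exp (?s * (1 - D))"
      by (simp add: algebra_simps flip: exp_add)
    have "f u \<le> tube F (exp (- t)) * exp (u * (1 - D))"
      unfolding f_def using hi by (intro mult_right_mono) auto
    also have "\<dots> = f t * exp (?s * (1 - D))" by (simp add: f_def eu mult.assoc)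
    also have "\<dots> \<le> f t * exp ((1 + D) * ?s)"
      using f_bound(1)[OF tu(1)] tu D_pos by (intro mult_left_mono) (auto simp: algebra_simps mult_left_mono)
    finally have "f u - f t \<le> f t * (exp ((1 + D) * ?s) - 1)" by (simp add: algebra_simps)
    also have "\<dots> \<le> C * (exp ((1 + D) * ?s) - 1)"
      using f_bound(2)[OF tu(1)] tu D_pos by (intro mult_right_mono) auto
    finally have 1: "f u - f t \<le> C * (exp ((1 + D) * ?s) - 1)" .
    have "f t \<le> exp ?s * tube F (exp (- u)) * exp (t * (1 - D))"
      unfolding f_def using lo by (intro mult_right_mono) auto
    also have "\<dots> = f u * exp (?s * D)"
    proof -
      have "exp ?s * exp (t * (1 - D)) = exp (u * (1 - D)) * exp (?s * D)"
        by (simp add: algebra_simps flip: exp_add)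
      then show ?thesis by (simp add: f_def mult_ac)
    qed
    also have "\<dots> \<le> f u * exp ((1 + D) * ?s)"
      using f_bound(1)[of u] tu D_pos by (intro mult_left_mono) (auto simp: algebra_simps)
    finally have "f t - f u \<le> f u * (exp ((1 + D) * ?s) - 1)" by (simp add: algebra_simps)
    also have "\<dots> \<le> C * (exp ((1 + D) * ?s) - 1)"
      using f_bound(2)[of u] tu D_pos by (intro mult_right_mono) auto
    finally have "f t - f u \<le> C * (exp ((1 + D) * ?s) - 1)" .
    with 1 show ?thesis by linarith
  qed
  have ucont: "uniformly_continuous_on {0..} f"
    unfolding uniformly_continuous_on_def
  proof (intro allI impI)
    fix e :: real assume "0 < e"
    have "((\<lambda>s. C * (exp ((1 + D) * s) - 1)) \<longlongrightarrow> C * (exp ((1 + D) * 0) - 1)) (at 0)"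
      by (intro tendsto_intros)
    then have "\<forall>\<^sub>F s in at 0. C * (exp ((1 + D) * s) - 1) < e"
      using order_tendstoD(2) \<open>0 < e\<close> by fastforce
    then obtain d where d: "0 < d" "\<And>s. s \<noteq> 0 \<Longrightarrow> \<bar>s\<bar> < d \<Longrightarrow> C * (exp ((1 + D) * s) - 1) < e"
      unfolding eventually_at by (auto simp: dist_real_def)
    have close: "\<bar>f t - f u\<bar> < e" if "0 \<le> t" "t \<le> u" "u - t < d" for t u
      using modulus[OF that(1,2)] d(2)[of "u - t"] that \<open>0 < e\<close> by (cases "t = u") auto
    have "dist (f y) (f x) < e" if "x \<in> {0..}" "y \<in> {0..}" "dist y x < d" for x y
      using close[of x y] close[of y x] that by (cases "x \<le> y") (auto simp: dist_real_def abs_minus_commute)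
    with d(1) show "\<exists>d>0. \<forall>x\<in>{0..}. \<forall>y\<in>{0..}. dist y x < d \<longrightarrow> dist (f y) (f x) < e" by blast
  qed
  have ineq: "f t \<le> (\<Sum>i\<in>{1..N}. r i powr D * f (t - \<tau> i))" for t
  proof -
    have "tube F (exp (- t)) \<le> (\<Sum>u\<in>(\<lambda>i. [i]) ` {1..N}. ratio u * tube F (exp (- t) / ratio u))"
    proof (rule tube_subadditive)
      show "F \<subseteq> (\<Union>u\<in>(\<lambda>i. [i]) ` {1..N}. cyl u)"
        using F_eq by (auto simp: cyl_def)
    qed auto
    also have "\<dots> = (\<Sum>i\<in>{1..N}. r i * tube F (exp (- t) / r i))"
      by (subst sum.reindex) (auto simp: inj_on_def)
    finally have "f t \<le> (\<Sum>i\<in>{1..N}. r i * tube F (exp (- t) / r i)) * exp (t * (1 - D))"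
      unfolding f_def by (intro mult_right_mono) auto
    also have "\<dots> = (\<Sum>i\<in>{1..N}. r i powr D * f (t - \<tau> i))"
      unfolding sum_distrib_right
    proof (rule sum.cong[OF refl])
      fix i assume i: "i \<in> {1..N}"
      have ri: "0 < r i" using r_bounds[OF i] by simp
      have 1: "exp (- (t - \<tau> i)) = exp (- t) / r i"
        using ri by (simp add: \<tau>_def exp_diff exp_minus field_simps exp_add)
      have 2: "r i powr D * exp ((t - \<tau> i) * (1 - D)) = r i * exp (t * (1 - D))"
        using ri by (simp add: \<tau>_def powr_def algebra_simps exp_add exp_diff exp_minus)
      have "r i * tube F (exp (- t) / r i) * exp (t * (1 - D))
          = r i * exp (t * (1 - D)) * tube F (exp (- t) / r i)" by simp
      then show "r i * tube F (exp (- t) / r i) * exp (t * (1 - D)) = r i powr D * f (t - \<tau> i)"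
        unfolding 2[symmetric] f_def 1 by (simp only: mult_ac)
    qed
    finally show ?thesis .
  qed
  have \<tau>_pos: "0 < \<tau> i" if "i \<in> {1..N}" for i using r_bounds[OF that] by (simp add: \<tau>_def)
  have dense: "\<exists>S. \<forall>s\<ge>S. \<exists>g\<in>semigroup_closure (\<tau> ` {1..N}). \<bar>g - s\<bar> < e" if "0 < e" for e
  proof -
    have "\<not> discrete (group_closure (uminus ` \<tau> ` {1..N}))"
      using nonlattice by (simp add: lattice_ratios_def image_image \<tau>_def)
    then show ?thesis
      using semigroup_closure_eventually_dense[of "\<tau> ` {1..N}" e] \<tau>_pos that by blast
  qed
  have "\<exists>L. (f \<longlongrightarrow> L) at_top"
  proof (rule renewal_inequality_limit[where I = "{1..N}" and p = "\<lambda>i. r i powr D" and \<tau> = \<tau>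
        and A = "- ln rmin" and B = C])
    show "\<tau> i \<le> - ln rmin" if "i \<in> {1..N}" for i
      using rmin r_bounds[OF that] that by (simp add: \<tau>_def)
    show "0 < r i powr D" if "i \<in> {1..N}" for i using r_bounds[OF that] by simp
  qed (use N Moran \<tau>_pos dense f_bound ucont ineq in auto)
  then obtain L where L: "(f \<longlongrightarrow> L) at_top" by blast
  have "filterlim (\<lambda>\<delta>::real. - ln \<delta>) at_top (at_right 0)"
    using ln_at_0 by (simp add: filterlim_uminus_at_top)
  from filterlim_compose[OF L this] have "((\<lambda>\<delta>. f (- ln \<delta>)) \<longlongrightarrow> L) (at_right 0)" .
  moreover have "\<forall>\<^sub>F \<delta> in at_right 0. f (- ln \<delta>) = tube F \<delta> * \<delta> powr (D - 1)"
    using eventually_at_right_less[of 0]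
    by eventually_elim (simp add: f_def powr_def algebra_simps)
  ultimately have "((\<lambda>\<delta>. tube F \<delta> * \<delta> powr (D - 1)) \<longlongrightarrow> L) (at_right 0)"
    by (rule Lim_transform_eventually)
  then show ?thesis ..
qed

lemma limit_positive:
  assumes "((\<lambda>\<delta>. tube F \<delta> * \<delta> powr (D - 1)) \<longlongrightarrow> L) (at_right 0)"
  shows "0 < L"
proof -
  obtain c where c: "0 < c" "\<And>\<delta>. 0 < \<delta> \<Longrightarrow> \<delta> \<le> 1 \<Longrightarrow> c * \<delta> powr (1 - D) \<le> tube F \<delta>"
    using tube_lower_bound by blast
  have "\<forall>\<^sub>F \<delta> in at_right 0. 0 < \<delta> \<and> \<delta> < (1::real)"
    by (rule eventually_at_rightI[of 0 1]) auto
  then have "\<forall>\<^sub>F \<delta> in at_right 0. c \<le> tube F \<delta> * \<delta> powr (D - 1)"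
  proof eventually_elim
    case (elim \<delta>)
    have "c * \<delta> powr (1 - D) * \<delta> powr (D - 1) \<le> tube F \<delta> * \<delta> powr (D - 1)"
      using c(2)[of \<delta>] elim by (intro mult_right_mono) auto
    moreover have "\<delta> powr (1 - D) * \<delta> powr (D - 1) = 1" using elim by (simp flip: powr_add)
    ultimately show ?case by (simp add: mult.assoc)
  qed
  then have "c \<le> L" by (rule tendsto_lowerbound[OF assms]) simp
  with c(1) show ?thesis by simp
qed

section \<open>Lattice systems\<close>

text \<open>
  Locate the start of a gap with length in \<open>(\<rho>\<^bsup>n+1\<^esup>, \<rho>\<^sup>n]\<close> first in a cylinder \<open>a\<close> of size about
  \<open>\<rho>\<^sup>n / \<beta>\<close> and then inside it, either in a cylinder \<open>c\<close> of \<open>B\<close> or in one of the form \<open>kw\<close>.  The factor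
  \<open>\<beta>\<close> is chosen so that the cylinder of \<open>akw\<close> has size at least \<open>\<rho>\<^sup>n\<close>.  In the second case the other
  end of the gap thus lies in the cylinder of \<open>ak\<close> as well, and the gap is the image of a gap of \<open>F\<close> of
  length at least \<open>\<rho> \<beta>\<close>.  There are finitely many such lengths, and the ratio of \<open>ak\<close>, a power of \<open>\<rho>\<close>
  between \<open>\<rho>\<^sup>n\<close> and \<open>\<rho>\<^sup>n / \<beta>\<close>, takes boundedly many values, so up to the factor \<open>\<rho>\<^sup>n\<close> the gap has one of
  finitely many lengths independent of \<open>n\<close>.
\<close>

lemma lattice_gap_cover:
  assumes \<rho>: "0 < \<rho>" "\<rho> < 1" and powers: "\<And>i. i \<in> {1..N} \<Longrightarrow> \<exists>j::nat. r i = \<rho> ^ j"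
    and w: "w \<in> words"
    and iso: "\<And>k x y. \<lbrakk>k \<in> words; x \<in> cyl (k @ w); y \<in> F; \<bar>x - y\<bar> \<le> ratio (k @ w)\<rbrakk> \<Longrightarrow> y \<in> cyl k"
    and B: "B \<subseteq> words" "0 < \<gamma>"
      "\<And>z. z \<in> F \<Longrightarrow> (\<exists>c\<in>B. z \<in> cyl c) \<or> (\<exists>k\<in>words. \<gamma> \<le> ratio k \<and> z \<in> cyl (k @ w))"
  obtains \<beta> T where "finite T" "\<And>x. x \<in> T \<Longrightarrow> 0 < x" "\<beta> = ratio w * rmin * \<gamma>"
    "\<And>n. \<rho> ^ n \<le> \<beta> \<Longrightarrow> gap_starts F (\<rho> ^ Suc n) - gap_starts F (\<rho> ^ n)
      \<subseteq> (\<Union>(a, c)\<in>stopped (\<rho> ^ n / \<beta>) \<times> B. gap_starts F (\<rho> ^ Suc n) \<inter> cyl (a @ c))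
        \<union> (\<Union>x\<in>T. gaps_of_length F (\<rho> ^ n * x))"
proof -
  define \<beta> where "\<beta> = ratio w * rmin * \<gamma>"
  have rw: "0 < ratio w" "ratio w \<le> 1" using w by (simp_all add: ratio_pos ratio_le_1)
  have \<beta>: "0 < \<beta>" using rw rmin B(2) by (simp add: \<beta>_def)
  \<comment> \<open>The ratios of the words \<open>ak\<close> that occur are \<open>\<rho> ^ (n - i)\<close> with \<open>i\<close> in \<open>exponents\<close>, and they multiply
  the members of \<open>lengths\<close>.\<close>
  define lengths where "lengths = {l. \<rho> * \<beta> \<le> l \<and> gaps_of_length F l \<noteq> {}}"
  define exponents where "exponents = {i::nat. \<beta> \<le> \<rho> ^ i}"
  define T where "T = (\<lambda>(l, i). l / \<rho> ^ i) ` (lengths \<times> exponents)"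
  have "finite lengths"
  proof -
    have not_shorter: "\<not> l < l'"
      if "y \<in> gaps_of_length F l" "y \<in> gaps_of_length F l'" "0 < l" for y l l'
    proof
      assume "l < l'"
      with that(3) have "y + l \<in> {y<..<y + l'}" by simp
      then show False using that(1,2) unfolding gaps_of_length_def by blast
    qed
    have pos: "0 < l" if "l \<in> lengths" for l
      using that less_le_trans[OF mult_pos_pos[OF \<rho>(1) \<beta>]] by (simp add: lengths_def)
    have "\<forall>l\<in>lengths. \<exists>y. y \<in> gaps_of_length F l" by (auto simp: lengths_def)
    then obtain g where g: "\<And>l. l \<in> lengths \<Longrightarrow> g l \<in> gaps_of_length F l" by metis
    have "inj_on g lengths" using g not_shorter pos by (metis inj_onI linorder_neqE)
    moreover have "g ` lengths \<subseteq> gap_starts F (\<rho> * \<beta> / 2)"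
    proof
      fix y assume "y \<in> g ` lengths"
      then obtain l where l: "l \<in> lengths" "y \<in> gaps_of_length F l" using g by blast
      have "\<rho> * \<beta> / 2 < l" using l(1) pos[OF l(1)] by (simp add: lengths_def)
      then show "y \<in> gap_starts F (\<rho> * \<beta> / 2)"
        using l(2) by (fastforce simp: gaps_of_length_def gap_starts_def)
    qed
    moreover have "finite (gap_starts F (\<rho> * \<beta> / 2))" using \<rho> \<beta> by (intro finite_gap_starts F_compact) simp
    ultimately show ?thesis by (meson finite_imageD finite_subset)
  qed
  moreover have "finite exponents"
  proof -
    obtain n where "\<rho> ^ n < \<beta>" using real_arch_pow_inv[OF \<beta> \<rho>(2)] by blast
    have "i \<le> n" if "i \<in> exponents" for i
    proof (rule ccontr)
      assume "\<not> i \<le> n"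
      then have "\<rho> ^ i \<le> \<rho> ^ n" using \<rho> by (intro power_decreasing) auto
      with that \<open>\<rho> ^ n < \<beta>\<close> show False by (simp add: exponents_def)
    qed
    then have "exponents \<subseteq> {..n}" by blast
    then show ?thesis by (rule finite_subset) simp
  qed
  ultimately have finT: "finite T" by (simp add: T_def)
  have Tpos: "0 < x" if "x \<in> T" for x
    using that \<rho> less_le_trans[OF mult_pos_pos[OF \<rho>(1) \<beta>]]
    by (auto simp: T_def lengths_def intro!: divide_pos_pos)
  have cover: "gap_starts F (\<rho> ^ Suc n) - gap_starts F (\<rho> ^ n)
      \<subseteq> (\<Union>(a, c)\<in>stopped (\<rho> ^ n / \<beta>) \<times> B. gap_starts F (\<rho> ^ Suc n) \<inter> cyl (a @ c))
        \<union> (\<Union>x\<in>T. gaps_of_length F (\<rho> ^ n * x))" if n: "\<rho> ^ n \<le> \<beta>" for n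
  proof
    fix y assume y: "y \<in> gap_starts F (\<rho> ^ Suc n) - gap_starts F (\<rho> ^ n)"
    define S where "S = \<rho> ^ n / \<beta>"
    have S: "0 < S" "S \<le> 1" using n \<rho> \<beta> by (simp_all add: S_def)
    have \<rho>n: "0 < \<rho> ^ n" using \<rho> by simp
    obtain l where l: "\<rho> ^ Suc n < l" "l \<le> \<rho> ^ n" "y \<in> gaps_of_length F l"
      using gap_start_has_end[OF F_compact, of y "\<rho> ^ Suc n" "\<rho> ^ n"] y \<rho> by auto
    have l0: "0 < l" using l(1) \<rho> by (meson less_trans zero_less_power)
    have yF: "y \<in> F" "y + l \<in> F" "F \<inter> {y<..<y + l} = {}" using l(3) by (auto simp: gaps_of_length_def)
    obtain a where a: "a \<in> stopped S" "y \<in> cyl a" using stopped_cover[OF S(1)] yF(1) by blast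
    have aw: "a \<in> words" using a(1) by (rule stopped_words)
    obtain z where z: "z \<in> F" "y = foldr \<phi> a z" using a(2) by (auto simp: cyl_def)
    from B(3)[OF z(1)]
    show "y \<in> (\<Union>(a, c)\<in>stopped (\<rho> ^ n / \<beta>) \<times> B. gap_starts F (\<rho> ^ Suc n) \<inter> cyl (a @ c))
        \<union> (\<Union>x\<in>T. gaps_of_length F (\<rho> ^ n * x))"
    proof (elim disjE bexE conjE)
      fix c assume "c \<in> B" "z \<in> cyl c"
      then have "y \<in> cyl (a @ c)" using z(2) by (simp add: cyl_append)
      then show ?thesis using \<open>c \<in> B\<close> a(1) y unfolding S_def by blast
    next
      fix k assume k: "k \<in> words" "\<gamma> \<le> ratio k" "z \<in> cyl (k @ w)"
      let ?k = "a @ k"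
      have kw: "?k \<in> words" using aw k(1) by simp
      have rk: "0 < ratio ?k" using kw by (rule ratio_pos)
      have "y \<in> cyl (a @ (k @ w))" unfolding cyl_append[of a] using z(2) k(3) by blast
      then have y_cyl: "y \<in> cyl (?k @ w)" by simp
      have "(rmin * S) * \<gamma> \<le> ratio a * ratio k"
        using stopped_ratio_ge[OF a(1) S(2)] k(2) B(2) rmin S ratio_pos[OF aw] by (intro mult_mono) auto
      then have "(rmin * S) * \<gamma> * ratio w \<le> ratio (?k @ w)"
        using rw by (simp add: mult_right_mono)
      moreover have "(rmin * S) * \<gamma> * ratio w = \<rho> ^ n"
        using rw(1) rmin(1) B(2) by (simp add: S_def \<beta>_def)
      ultimately have ge: "\<rho> ^ n \<le> ratio (?k @ w)" by simp
      have "y + l \<in> cyl ?k"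
        by (rule iso[OF kw y_cyl yF(2)]) (use ge l l0 in simp)
      moreover have "y \<in> cyl ?k" using cyl_append_subset[OF kw w] y_cyl by blast
      ultimately have gap: "gaps_of_length F (l / ratio ?k) \<noteq> {}"
        using gap_pullback[OF kw _ _ l0 yF(3)] by blast
      have "ratio ?k \<le> ratio a * 1"
        using ratio_le_1[OF k(1)] ratio_pos[OF aw] by simp
      then have le: "ratio ?k \<le> S" using stopped_ratio_le[OF a(1)] by simp
      have "\<rho> * \<beta> = \<rho> ^ Suc n / S" using \<rho> \<beta> by (simp add: S_def)
      also have "\<dots> \<le> l / ratio ?k" using l(1) le rk l0 by (intro frac_le) auto
      finally have len: "l / ratio ?k \<in> lengths" using gap by (simp add: lengths_def)
      obtain j where j: "ratio ?k = \<rho> ^ j" using log_periodic_ratio[OF powers kw] by blast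
      have "ratio (?k @ w) \<le> ratio ?k" using mult_left_mono[OF rw(2), of "ratio ?k"] rk by (simp add: mult.assoc)
      then have "\<rho> ^ n \<le> \<rho> ^ j" using ge j by linarith
      then have jn: "j \<le> n" using power_strict_decreasing[of n j \<rho>] \<rho> by (meson leD leI)
      then have split: "\<rho> ^ n = \<rho> ^ j * \<rho> ^ (n - j)" by (simp flip: power_add)
      have "\<rho> ^ j * \<beta> \<le> \<rho> ^ j * \<rho> ^ (n - j)"
        using le \<beta> unfolding j S_def split by (simp add: field_simps)
      then have "n - j \<in> exponents" using \<rho> by (simp add: exponents_def)
      with len have "l / ratio ?k / \<rho> ^ (n - j) \<in> T" unfolding T_def by force
      moreover have "\<rho> ^ n * (l / ratio ?k / \<rho> ^ (n - j)) = l"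
        using \<rho> unfolding j split by simp
      ultimately show ?thesis using l(3) by force
    qed
  qed
  show thesis using that[OF finT Tpos \<beta>_def cover] .
qed

text \<open>
  Count the gaps with lengths in \<open>(\<rho>\<^bsup>n+1\<^esup>, \<rho>\<^sup>n]\<close> by means of \<open>lattice_gap_cover\<close>, multiply by \<open>(\<rho>\<^sup>n)\<^sup>D\<close> and
  let \<open>n\<close> tend to infinity.  The gaps with one of the finitely many exceptional lengths disappear in
  the limit, and those that start in cylinders avoiding \<open>w\<close> are controlled by the weight of
  these cylinders.
\<close>

lemma lattice_gap_bound:
  assumes \<rho>: "0 < \<rho>" "\<rho> < 1" and powers: "\<And>i. i \<in> {1..N} \<Longrightarrow> \<exists>j::nat. r i = \<rho> ^ j"
    and w: "w \<in> words"
    and iso: "\<And>k x y. \<lbrakk>k \<in> words; x \<in> cyl (k @ w); y \<in> F; \<bar>x - y\<bar> \<le> ratio (k @ w)\<rbrakk> \<Longrightarrow> y \<in> cyl k"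
    and C: "0 \<le> C" "\<And>\<delta>. 0 < \<delta> \<Longrightarrow> \<delta> \<le> 1 \<Longrightarrow> tube F \<delta> \<le> C * \<delta> powr (1 - D)"
    and lim: "((\<lambda>\<delta>. real (card (gap_starts F \<delta>)) * \<delta> powr D) \<longlongrightarrow> G) (at_right 0)"
  shows "G * (\<rho> powr (- D) - 1) \<le> C * \<rho> powr (- D) * (1 - ratio w powr D) ^ m"
proof -
  define \<gamma> where "\<gamma> = (rmin * ratio w) ^ m"
  have rw: "0 < ratio w" "ratio w \<le> 1" using w by (simp_all add: ratio_pos ratio_le_1)
  have \<gamma>: "0 < \<gamma>" using rw rmin by (simp add: \<gamma>_def)
  obtain B where B: "finite B" "B \<subseteq> words" "\<And>c. c \<in> B \<Longrightarrow> \<gamma> \<le> ratio c"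
    "(\<Sum>c\<in>B. ratio c powr D) \<le> (1 - ratio w powr D) ^ m"
    "\<And>z. z \<in> F \<Longrightarrow> (\<exists>c\<in>B. z \<in> cyl c) \<or> (\<exists>k\<in>words. \<gamma> \<le> ratio k \<and> z \<in> cyl (k @ w))"
    using avoiding_words[OF w, of m] unfolding \<gamma>_def by blast
  obtain \<beta> T where T: "finite T" "\<And>x. x \<in> T \<Longrightarrow> 0 < x" and \<beta>: "\<beta> = ratio w * rmin * \<gamma>" and
    cover: "\<And>n. \<rho> ^ n \<le> \<beta> \<Longrightarrow> gap_starts F (\<rho> ^ Suc n) - gap_starts F (\<rho> ^ n)
      \<subseteq> (\<Union>(a, c)\<in>stopped (\<rho> ^ n / \<beta>) \<times> B. gap_starts F (\<rho> ^ Suc n) \<inter> cyl (a @ c))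
        \<union> (\<Union>x\<in>T. gaps_of_length F (\<rho> ^ n * x))"
    by (rule lattice_gap_cover[OF \<rho> powers w iso B(2) \<gamma> B(5)]) blast+
  have \<beta>0: "0 < \<beta>" using rw rmin \<gamma> by (simp add: \<beta>)
  let ?M = "C * (1 - ratio w powr D) ^ m"
  have M: "0 \<le> (1 - ratio w powr D) ^ m"
    using B(4) sum_nonneg[of B "\<lambda>c. ratio c powr D"] by simp
  have \<rho>lim: "filterlim (\<lambda>n. \<rho> ^ n) (at_right 0) sequentially"
    unfolding filterlim_at using \<rho> LIMSEQ_power_zero[of \<rho>] by simp
  have gap_lim: "((\<lambda>n. real (card (gaps_of_length F (\<rho> ^ n * x))) * (\<rho> ^ n * x) powr D) \<longlongrightarrow> 0) sequentially"
    if "0 < x" for x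
    using filterlim_compose[OF few_gaps_of_equal_length[OF F_compact lim]
        filterlim_compose[OF filterlim_times_at_right_0[OF that] \<rho>lim]]
    by (simp add: mult.commute[of x])
  have bound: "real (card (gap_starts F (\<rho> ^ Suc n))) * (\<rho> ^ Suc n) powr D * \<rho> powr (- D)
        - real (card (gap_starts F (\<rho> ^ n))) * (\<rho> ^ n) powr D
      \<le> ?M * \<rho> powr (- D)
        + (\<Sum>x\<in>T. real (card (gaps_of_length F (\<rho> ^ n * x))) * (\<rho> ^ n * x) powr D * x powr (- D))"
    if n: "\<rho> ^ n \<le> \<beta>" for n
  proof -
    let ?d = "\<rho> ^ Suc n"
    have \<rho>n: "0 < \<rho> ^ n" "0 < ?d" "?d \<le> \<rho> ^ n" using \<rho> by (auto simp: mult_left_le_one_le)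
    define S where "S = \<rho> ^ n / \<beta>"
    have S: "0 < S" "S \<le> 1" using n \<rho>n \<beta>0 by (simp_all add: S_def)
    have finS: "finite (stopped S)" using S(1) by (rule finite_stopped)
    have fin: "finite (gap_starts F ?d)" "finite (gap_starts F (\<rho> ^ n))"
      using \<rho>n by (auto intro!: finite_gap_starts F_compact)
    have fin_gap: "finite (gaps_of_length F (\<rho> ^ n * x))" if "x \<in> T" for x
    proof (rule finite_subset)
      have "0 < \<rho> ^ n * x" using \<rho>n T(2)[OF that] by simp
      then show "gaps_of_length F (\<rho> ^ n * x) \<subseteq> gap_starts F (\<rho> ^ n * x / 2)"
        by (fastforce simp: gaps_of_length_def gap_starts_def)
      show "finite (gap_starts F (\<rho> ^ n * x / 2))"
        using \<open>0 < \<rho> ^ n * x\<close> by (intro finite_gap_starts F_compact) simp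
    qed
    have "real (card (gap_starts F ?d)) - real (card (gap_starts F (\<rho> ^ n)))
        = real (card (gap_starts F ?d - gap_starts F (\<rho> ^ n)))"
      using card_Diff_subset[OF fin(2) gap_starts_antimono[OF \<rho>n(3), of F]]
        card_mono[OF fin(1) gap_starts_antimono[OF \<rho>n(3), of F]] by simp
    also have "\<dots> \<le> real (card ((\<Union>(a, c)\<in>stopped S \<times> B. gap_starts F ?d \<inter> cyl (a @ c))
        \<union> (\<Union>x\<in>T. gaps_of_length F (\<rho> ^ n * x))))"
      unfolding of_nat_le_iff
    proof (rule card_mono)
      show "finite ((\<Union>(a, c)\<in>stopped S \<times> B. gap_starts F ?d \<inter> cyl (a @ c))
        \<union> (\<Union>x\<in>T. gaps_of_length F (\<rho> ^ n * x)))"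
        using finS B(1) T(1) fin(1) fin_gap by auto
      show "gap_starts F ?d - gap_starts F (\<rho> ^ n) \<subseteq>
          (\<Union>(a, c)\<in>stopped S \<times> B. gap_starts F ?d \<inter> cyl (a @ c)) \<union> (\<Union>x\<in>T. gaps_of_length F (\<rho> ^ n * x))"
        unfolding S_def by (rule cover[OF n])
    qed
    also have "\<dots> \<le> real (card (\<Union>(a, c)\<in>stopped S \<times> B. gap_starts F ?d \<inter> cyl (a @ c)))
        + real (card (\<Union>x\<in>T. gaps_of_length F (\<rho> ^ n * x)))"
      unfolding of_nat_add[symmetric] of_nat_le_iff by (rule card_Un_le)
    also have "real (card (\<Union>x\<in>T. gaps_of_length F (\<rho> ^ n * x)))
        \<le> (\<Sum>x\<in>T. real (card (gaps_of_length F (\<rho> ^ n * x))))"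
      unfolding of_nat_sum[symmetric] of_nat_le_iff using T(1) by (rule card_UN_le)
    also have "real (card (\<Union>(a, c)\<in>stopped S \<times> B. gap_starts F ?d \<inter> cyl (a @ c)))
        \<le> (\<Sum>(a, c)\<in>stopped S \<times> B. real (card (gap_starts F ?d \<inter> cyl (a @ c))))"
      using card_UN_le[of "stopped S \<times> B" "\<lambda>(a, c). gap_starts F ?d \<inter> cyl (a @ c)"] finS B(1)
      by (simp add: case_prod_unfold flip: of_nat_sum)
    also have "\<dots> \<le> (\<Sum>(a, c)\<in>stopped S \<times> B. C * ?d powr (- D) * (ratio a powr D * ratio c powr D))"
    proof (rule sum_mono, clarify)
      fix a c assume a: "a \<in> stopped S" and c: "c \<in> B"
      have aw: "a \<in> words" and cw: "c \<in> words" using a c B(2) stopped_words by auto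
      have "\<rho> ^ n \<le> \<rho> ^ n / ratio w" using \<rho>n rw by (simp add: field_simps)
      also have "\<dots> = (rmin * S) * \<gamma>" using \<beta>0 \<gamma> rmin rw by (simp add: S_def \<beta> field_simps)
      also have "\<dots> \<le> ratio a * ratio c"
        using stopped_ratio_ge[OF a S(2)] B(3)[OF c] \<gamma> rmin S ratio_pos[OF aw] by (intro mult_mono) auto
      finally have "?d \<le> ratio (a @ c)" using \<rho>n by simp
      from card_gap_starts_cyl[OF C(2) _ \<rho>n(2) this] aw cw
      have "real (card (gap_starts F ?d \<inter> cyl (a @ c))) \<le> C * ratio (a @ c) powr D * ?d powr (- D)"
        by simp
      also have "\<dots> = C * ?d powr (- D) * (ratio a powr D * ratio c powr D)"
        using ratio_pos[OF aw] ratio_pos[OF cw] by (simp add: powr_mult)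
      finally show "real (card (gap_starts F ?d \<inter> cyl (a @ c)))
          \<le> C * ?d powr (- D) * (ratio a powr D * ratio c powr D)" .
    qed
    also have "\<dots> = C * ?d powr (- D) * ((\<Sum>a\<in>stopped S. ratio a powr D) * (\<Sum>c\<in>B. ratio c powr D))"
      unfolding sum_product sum.cartesian_product
      by (simp add: sum_distrib_left case_prod_unfold)
    also have "\<dots> \<le> C * ?d powr (- D) * (1 * (1 - ratio w powr D) ^ m)"
      unfolding sum_stopped[OF S(1)] using C(1) B(4) by (intro mult_left_mono) auto
    finally have "real (card (gap_starts F ?d)) - real (card (gap_starts F (\<rho> ^ n)))
        \<le> ?M * ?d powr (- D) + (\<Sum>x\<in>T. real (card (gaps_of_length F (\<rho> ^ n * x))))"
      by (simp add: mult_ac)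
    then have "(real (card (gap_starts F ?d)) - real (card (gap_starts F (\<rho> ^ n)))) * (\<rho> ^ n) powr D
        \<le> (?M * ?d powr (- D) + (\<Sum>x\<in>T. real (card (gaps_of_length F (\<rho> ^ n * x))))) * (\<rho> ^ n) powr D"
      by (intro mult_right_mono) auto
    also have "\<dots> = ?M * (?d powr (- D) * (\<rho> ^ n) powr D)
        + (\<Sum>x\<in>T. real (card (gaps_of_length F (\<rho> ^ n * x))) * (\<rho> ^ n) powr D)"
      by (simp only: distrib_right sum_distrib_right mult.assoc)
    also have "?d powr (- D) * (\<rho> ^ n) powr D = \<rho> powr (- D)"
      using \<rho> by (simp add: powr_mult powr_minus)
    also have "(\<Sum>x\<in>T. real (card (gaps_of_length F (\<rho> ^ n * x))) * (\<rho> ^ n) powr D)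
        = (\<Sum>x\<in>T. real (card (gaps_of_length F (\<rho> ^ n * x))) * (\<rho> ^ n * x) powr D * x powr (- D))"
    proof (rule sum.cong[OF refl])
      fix x assume "x \<in> T"
      then have "0 < x" by (rule T(2))
      then have "(\<rho> ^ n * x) powr D * x powr (- D) = (\<rho> ^ n) powr D"
        using \<rho>n by (simp add: powr_mult powr_minus)
      then show "real (card (gaps_of_length F (\<rho> ^ n * x))) * (\<rho> ^ n) powr D
          = real (card (gaps_of_length F (\<rho> ^ n * x))) * (\<rho> ^ n * x) powr D * x powr (- D)"
        by (simp only: mult.assoc)
    qed
    also have "(real (card (gap_starts F ?d)) - real (card (gap_starts F (\<rho> ^ n)))) * (\<rho> ^ n) powr D
        = real (card (gap_starts F ?d)) * ?d powr D * \<rho> powr (- D) - real (card (gap_starts F (\<rho> ^ n))) * (\<rho> ^ n) powr D"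
    proof -
      have "?d powr D * \<rho> powr (- D) = (\<rho> ^ n) powr D"
        using \<rho> by (simp add: powr_mult powr_minus)
      then show ?thesis by (simp only: left_diff_distrib mult.assoc)
    qed
    finally show ?thesis .
  qed
  have "((\<lambda>n. real (card (gap_starts F (\<rho> ^ Suc n))) * (\<rho> ^ Suc n) powr D * \<rho> powr (- D)
        - real (card (gap_starts F (\<rho> ^ n))) * (\<rho> ^ n) powr D) \<longlongrightarrow> G * \<rho> powr (- D) - G) sequentially"
    by (intro tendsto_diff tendsto_mult_right filterlim_compose[OF lim] \<rho>lim
        filterlim_compose[OF \<rho>lim filterlim_Suc])
  moreover have "((\<lambda>n. ?M * \<rho> powr (- D)
      + (\<Sum>x\<in>T. real (card (gaps_of_length F (\<rho> ^ n * x))) * (\<rho> ^ n * x) powr D * x powr (- D)))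
      \<longlongrightarrow> ?M * \<rho> powr (- D) + (\<Sum>x\<in>T. 0 * x powr (- D))) sequentially"
    by (intro tendsto_intros gap_lim T(2))
  moreover have "\<forall>\<^sub>F n in sequentially. \<rho> ^ n \<le> \<beta>"
    using order_tendstoD(2)[OF LIMSEQ_power_zero[of \<rho>] \<beta>0] \<rho> by (auto elim: eventually_mono)
  then have "\<forall>\<^sub>F n in sequentially. real (card (gap_starts F (\<rho> ^ Suc n))) * (\<rho> ^ Suc n) powr D * \<rho> powr (- D)
        - real (card (gap_starts F (\<rho> ^ n))) * (\<rho> ^ n) powr D
      \<le> ?M * \<rho> powr (- D)
        + (\<Sum>x\<in>T. real (card (gaps_of_length F (\<rho> ^ n * x))) * (\<rho> ^ n * x) powr D * x powr (- D))"
    by (rule eventually_mono) (rule bound)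
  ultimately have "G * \<rho> powr (- D) - G \<le> ?M * \<rho> powr (- D) + (\<Sum>x\<in>T. 0 * x powr (- D))"
    by (intro tendsto_le[OF sequentially_bot])
  then show ?thesis by (simp add: algebra_simps)
qed

text \<open>
  The upper bound for the normalised number of gaps with lengths in one period decays with the number
  \<open>m\<close> of blocks, whereas \<open>L > 0\<close> and \<open>D < 1\<close> make this number positive in the limit.
\<close>

lemma lattice_no_limit:
  assumes lattice: "lattice_ratios N r" and "D < 1"
    and lim: "((\<lambda>\<delta>. tube F \<delta> * \<delta> powr (D - 1)) \<longlongrightarrow> L) (at_right 0)"
  shows False
proof -
  obtain \<rho> where \<rho>: "0 < \<rho>" "\<rho> < 1" "\<And>i. i \<in> {1..N} \<Longrightarrow> \<exists>j::nat. r i = \<rho> ^ j"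
    using lattice_common_ratio[OF lattice] by blast
  obtain w where w: "w \<in> words"
    "\<And>k x y. \<lbrakk>k \<in> words; x \<in> cyl (k @ w); y \<in> F; \<bar>x - y\<bar> \<le> ratio (k @ w)\<rbrakk> \<Longrightarrow> y \<in> cyl k"
    using isolating_word by metis
  obtain C where C: "0 < C" "\<And>\<delta>. 0 < \<delta> \<Longrightarrow> \<delta> \<le> 1 \<Longrightarrow> tube F \<delta> \<le> C * \<delta> powr (1 - D)"
    using tube_upper_bound by blast
  let ?G = "L * (1 - D)"
  have "?G * (\<rho> powr (- D) - 1) \<le> C * \<rho> powr (- D) * (1 - ratio w powr D) ^ m" for m
    using lattice_gap_bound[OF \<rho> w less_imp_le[OF C(1)] C(2) gap_count_asymptotics[OF F_compact lim]] .
  moreover have "(\<lambda>m. C * \<rho> powr (- D) * (1 - ratio w powr D) ^ m) \<longlonglongrightarrow> C * \<rho> powr (- D) * 0"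
  proof (intro tendsto_mult_left LIMSEQ_power_zero)
    have "0 < ratio w powr D" "ratio w powr D \<le> 1"
      using w(1) ratio_pos[of w] ratio_le_1[of w] D_pos by (auto intro: powr_le1)
    then show "norm (1 - ratio w powr D) < 1" by simp
  qed
  ultimately have le: "?G * (\<rho> powr (- D) - 1) \<le> C * \<rho> powr (- D) * 0"
    by (intro LIMSEQ_le_const) auto
  have "1 < \<rho> powr (- D)"
    using \<rho> D_pos powr_less_mono2_neg[of "- D" \<rho> 1] by simp
  moreover have "0 < ?G" using limit_positive[OF lim] \<open>D < 1\<close> by simp
  ultimately have "0 < ?G * (\<rho> powr (- D) - 1)" by (metis diff_gt_0_iff_gt mult_pos_pos)
  with le show False by linarith
qed

end

section \<open>The equivalence\<close>

theorem corollary3p2: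
  fixes N :: nat and \<phi> :: "nat \<Rightarrow> real \<Rightarrow> real" and r :: "nat \<Rightarrow> real" and F :: "real set"
  assumes "N \<ge> 2"
    and "contracting_similarities N \<phi> r"
    and "open_set_condition N \<phi>"
    and "generates_self_similar_set N \<phi> F"
    and "minkowski_dim F < 1"
  shows "minkowski_measurable F \<longleftrightarrow> \<not> lattice_ratios N r"
proof -
  have "0 < r i \<and> r i < 1" if "i \<in> {1..N}" for i
    using assms(2) that by (simp add: contracting_similarities_def)
  then obtain D where "0 < D" "(\<Sum>i\<in>{1..N}. r i powr D) = 1"
    using similarity_dimension_exists[OF assms(1)] by blast
  then interpret osc_system N \<phi> r F D
    using assms by unfold_locales auto
  have "D < 1" using assms(5) minkowski_dimension(2) by simp
  then show ?thesis
    unfolding minkowski_measurable_iff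
    using nonlattice_limit limit_positive lattice_no_limit by blast
qed

end
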